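(* Let $(G,O,H,k)$ be an instance of Subgraph Isomorphism (respectively, of Longest Cycle, in which case $H$ is the empty graph) on unit disk/square graphs. Then, in polynomial time, one can output a set $\mathcal{I}$ of instances of Subgraph Isomorphism (respectively, Longest Cycle) on unit disk/square graphs such that $(G,O,H,k)$ is a yes-instance if and only if at least one instance in $\mathcal{I}$ is a yes-instance, and for every $(\widehat{G},\widehat{O},\widehat{H},\widehat{k})\in\mathcal{I}$ it holds that $|V(\widehat{G})|=\mathcal{O}(k^3)$, $|E(\widehat{G})|=\mathcal{O}(k^4)$, $\widehat{H}=H$ and $\widehat{k}=k$.
   Context: An instance of a problem on unit disk (resp. unit square) graphs consists of a finite point set $O$ in the plane and the graph $G$ it defines: $V(G)=O$, and distinct points $(x_i,y_i),(x_j,y_j)$ are adjacent iff $\sqrt{(x_i-x_j)^2+(y_i-y_j)^2}\le 2$ (resp. iff $|x_i-x_j|\le 1$ and $|y_i-y_j|\le 1$). Subgraph Isomorphism: given connected graphs $G$ and $H$, where $H$ has $k$ vertices, decide whether $G$ has a subgraph isomorphic to $H$; an instance is written $(G,O,H,k)$. Longest Cycle: given $G$ and integer $k$, decide whether $G$ has a cycle on at least $k$ vertices; an instance is written $(G,O,H,k)$ with $H$ the empty graph. *)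

theory Defs
  imports
    Complex_Main
    "HOL-Library.Landau_Symbols"
    "HOL-Computational_Algebra.Polynomial"
begin

section \<open>Simple undirected graphs\<close>

type_synonym 'a ugraph = "'a set \<times> 'a set set"

abbreviation verts :: "'a ugraph \<Rightarrow> 'a set" where "verts \<equiv> fst"
abbreviation edges :: "'a ugraph \<Rightarrow> 'a set set" where "edges \<equiv> snd"

definition simple_graph :: "'a ugraph \<Rightarrow> bool" where
  "simple_graph G \<longleftrightarrow>
     finite (verts G) \<and> (\<forall>e\<in>edges G. e \<subseteq> verts G \<and> card e = 2)"

definition empty_graph :: "'a ugraph" where
  "empty_graph = ({}, {})"

text \<open>The graph without vertices counts as connected.\<close>

definition connected_graph :: "'a ugraph \<Rightarrow> bool" where
  "connected_graph G \<longleftrightarrow>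
     (\<forall>u\<in>verts G. \<forall>v\<in>verts G. (\<lambda>x y. {x, y} \<in> edges G)\<^sup>*\<^sup>* u v)"

definition subgraph :: "'a ugraph \<Rightarrow> 'a ugraph \<Rightarrow> bool" where
  "subgraph S G \<longleftrightarrow>
     simple_graph S \<and> verts S \<subseteq> verts G \<and> edges S \<subseteq> edges G"

definition isomorphic :: "'a ugraph \<Rightarrow> 'b ugraph \<Rightarrow> bool" where
  "isomorphic G H \<longleftrightarrow>
     (\<exists>f. bij_betw f (verts G) (verts H) \<and> (\<lambda>e. f ` e) ` edges G = edges H)"

definition cycle :: "'a ugraph \<Rightarrow> 'a list \<Rightarrow> bool" where
  "cycle G vs \<longleftrightarrow>
     length vs \<ge> 3 \<and> distinct vs \<and> set vs \<subseteq> verts G \<and>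
     (\<forall>i<length vs. {vs ! i, vs ! ((i + 1) mod length vs)} \<in> edges G)"

section \<open>Unit disk and unit square graphs\<close>

type_synonym point = "real \<times> real"

datatype shape = Unit_Disk | Unit_Square

fun close :: "shape \<Rightarrow> point \<Rightarrow> point \<Rightarrow> bool" where
  "close Unit_Disk (x, y) (x', y') \<longleftrightarrow> sqrt ((x - x')\<^sup>2 + (y - y')\<^sup>2) \<le> 2"
| "close Unit_Square (x, y) (x', y') \<longleftrightarrow> \<bar>x - x'\<bar> \<le> 1 \<and> \<bar>y - y'\<bar> \<le> 1"

definition geometric_graph :: "shape \<Rightarrow> point set \<Rightarrow> point ugraph" where
  "geometric_graph s P = (P, {{p, q} | p q. p \<in> P \<and> q \<in> P \<and> p \<noteq> q \<and> close s p q})"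

section \<open>Problems and their instances\<close>

datatype problem = Subgraph_Isomorphism | Longest_Cycle

text \<open>Instances are quadruples \<open>(G, P, H, k)\<close>, where \<open>P\<close> is the point set.\<close>

type_synonym inst = "point ugraph \<times> point set \<times> nat ugraph \<times> int"

fun is_instance :: "problem \<Rightarrow> shape \<Rightarrow> inst \<Rightarrow> bool" where
  "is_instance Subgraph_Isomorphism s (G, P, H, k) \<longleftrightarrow>
     finite P \<and> G = geometric_graph s P \<and> connected_graph G \<and>
     simple_graph H \<and> connected_graph H \<and> k = int (card (verts H))"
| "is_instance Longest_Cycle s (G, P, H, k) \<longleftrightarrow>
     finite P \<and> G = geometric_graph s P \<and> H = empty_graph"

fun yes_instance :: "problem \<Rightarrow> inst \<Rightarrow> bool" where
  "yes_instance Subgraph_Isomorphism (G, P, H, k) \<longleftrightarrow> (\<exists>S. subgraph S G \<and> isomorphic S H)"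
| "yes_instance Longest_Cycle (G, P, H, k) \<longleftrightarrow> (\<exists>vs. cycle G vs \<and> int (length vs) \<ge> k)"

section \<open>The model of computation\<close>

text \<open>
  Points have real coordinates, so time is measured on a real RAM: it has a memory of integers
  and a memory of reals, both with indirect addressing, and every assignment and every test takes
  one step. Addresses are lists, which gives arrays of any fixed dimension.

  The arithmetic is more restricted than on the usual real RAM, so that unit cost cannot be
  abused. Integers are only added and subtracted. Reals are only combined linearly, with rational
  coefficients; their products may be tested, but not stored, and reals are never rounded to
  integers. Hence, on rational inputs, all numbers stored within \<open>t\<close> steps have bit length
  polynomial in \<open>t\<close> and in the bit length of the input, and a polynomial number of steps
  is also polynomial time on a Turing machine.
\<close>

type_synonym address = "int list"
type_synonym memory = "(address \<Rightarrow> int) \<times> (address \<Rightarrow> real)"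

datatype iexp =
    IConst int
  | ICell "iexp list"
  | IAdd iexp iexp
  | ISub iexp iexp

datatype lexp =
    LConst rat
  | LCell "iexp list"
  | LAdd lexp lexp
  | LSub lexp lexp
  | LScale rat lexp

datatype rexp =
    RLin lexp
  | RAdd rexp rexp
  | RSub rexp rexp
  | RMul rexp rexp

datatype test =
    ILe iexp iexp
  | RLe rexp rexp
  | TNot test
  | TAnd test test

datatype com =
    Skip
  | SetInt "iexp list" iexp
  | SetReal "iexp list" lexp
  | Seq com com
  | Cond test com com
  | While test com

primrec ival :: "memory \<Rightarrow> iexp \<Rightarrow> int" where
  "ival M (IConst c) = c"
| "ival M (ICell as) = fst M (map (ival M) as)"
| "ival M (IAdd a b) = ival M a + ival M b"
| "ival M (ISub a b) = ival M a - ival M b"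

primrec lval :: "memory \<Rightarrow> lexp \<Rightarrow> real" where
  "lval M (LConst c) = of_rat c"
| "lval M (LCell as) = snd M (map (ival M) as)"
| "lval M (LAdd a b) = lval M a + lval M b"
| "lval M (LSub a b) = lval M a - lval M b"
| "lval M (LScale c a) = of_rat c * lval M a"

primrec rval :: "memory \<Rightarrow> rexp \<Rightarrow> real" where
  "rval M (RLin a) = lval M a"
| "rval M (RAdd a b) = rval M a + rval M b"
| "rval M (RSub a b) = rval M a - rval M b"
| "rval M (RMul a b) = rval M a * rval M b"

primrec holds :: "memory \<Rightarrow> test \<Rightarrow> bool" where
  "holds M (ILe a b) \<longleftrightarrow> ival M a \<le> ival M b"
| "holds M (RLe a b) \<longleftrightarrow> rval M a \<le> rval M b"
| "holds M (TNot b) \<longleftrightarrow> \<not> holds M b"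
| "holds M (TAnd b c) \<longleftrightarrow> holds M b \<and> holds M c"

text \<open>\<open>exec c M t M'\<close>: started in \<open>M\<close>, the program \<open>c\<close> halts in \<open>M'\<close> after \<open>t\<close> steps.\<close>

inductive exec :: "com \<Rightarrow> memory \<Rightarrow> nat \<Rightarrow> memory \<Rightarrow> bool" where
  Skip: "exec Skip M 1 M"
| SetInt: "exec (SetInt as e) M 1 ((fst M)(map (ival M) as := ival M e), snd M)"
| SetReal: "exec (SetReal as e) M 1 (fst M, (snd M)(map (ival M) as := lval M e))"
| Seq: "exec c M t M' \<Longrightarrow> exec d M' u M'' \<Longrightarrow> exec (Seq c d) M (t + u) M''"
| CondTrue: "holds M b \<Longrightarrow> exec c M t M' \<Longrightarrow> exec (Cond b c d) M (t + 1) M'"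
| CondFalse: "\<not> holds M b \<Longrightarrow> exec d M t M' \<Longrightarrow> exec (Cond b c d) M (t + 1) M'"
| WhileFalse: "\<not> holds M b \<Longrightarrow> exec (While b c) M 1 M"
| WhileTrue: "holds M b \<Longrightarrow> exec c M t M' \<Longrightarrow> exec (While b c) M' u M'' \<Longrightarrow>
    exec (While b c) M (t + u + 1) M''"

section \<open>Instances in memory\<close>

text \<open>
  Below the address prefix \<open>a\<close>, an instance is stored as the number of points with their
  coordinates and the adjacency matrix of \<open>G\<close>, the number of vertices of \<open>H\<close> with their names and
  the adjacency matrix of \<open>H\<close>, and \<open>k\<close>. Vertices are listed in an arbitrary order, and nothing is
  assumed about other memory cells.
\<close>

fun stores_instance :: "memory \<Rightarrow> address \<Rightarrow> inst \<Rightarrow> bool" where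
  "stores_instance (W, R) a (G, P, H, k) \<longleftrightarrow>
     (\<exists>ps hs. distinct ps \<and> set ps = P \<and> distinct hs \<and> set hs = verts H \<and>
        W (a @ [0]) = int (length ps) \<and>
        (\<forall>i<length ps. R (a @ [0, int i]) = fst (ps ! i) \<and> R (a @ [1, int i]) = snd (ps ! i)) \<and>
        (\<forall>i<length ps. \<forall>j<length ps.
           W (a @ [1, int i, int j]) = (if {ps ! i, ps ! j} \<in> edges G then 1 else 0)) \<and>
        W (a @ [2]) = int (length hs) \<and>
        (\<forall>i<length hs. W (a @ [2, int i]) = int (hs ! i)) \<and>
        (\<forall>i<length hs. \<forall>j<length hs.
           W (a @ [3, int i, int j]) = (if {hs ! i, hs ! j} \<in> edges H then 1 else 0)) \<and>
        W (a @ [4]) = k)"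

definition stores_input :: "memory \<Rightarrow> inst \<Rightarrow> bool" where
  "stores_input M X \<longleftrightarrow> stores_instance M [0] X"

definition stores_output :: "memory \<Rightarrow> inst set \<Rightarrow> bool" where
  "stores_output M Xs \<longleftrightarrow>
     (\<exists>xs. set xs = Xs \<and> fst M [1] = int (length xs) \<and>
        (\<forall>j<length xs. stores_instance M [2, int j] (xs ! j)))"

text \<open>
  Polynomially related to the number of cells taken by the instance. The magnitudes of the stored
  numbers do not contribute, which only makes time bounds stronger.
\<close>

fun inst_size :: "inst \<Rightarrow> nat" where
  "inst_size (G, P, H, k) = card P + card (verts H)"

end

theory Submission imports Defs begin

text \<open>
  If some square of side \<open>1\<close> around a point contains \<open>m = max 3 k\<close> points, these form a clique and
  the answer is yes. Otherwise a square of side \<open>L\<close> contains only \<open>O(L\<^sup>2 m)\<close> points. A ball of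
  radius \<open>m\<close> in the graph fits into a square of side \<open>4 m\<close>, so it has \<open>O(m\<^sup>3)\<close> vertices of degree
  \<open>O(m)\<close>, and the instances to output are the graphs induced by these balls.

  A connected subgraph with \<open>k\<close> vertices lies in the ball around any of its vertices. A cycle with at
  least \<open>k\<close> vertices may leave the ball around one of its vertices \<open>u\<close>. It then contains a vertex
  \<open>w\<close> at distance more than \<open>m\<close> from \<open>u\<close>, and no third vertex separates \<open>u\<close> from \<open>w\<close>. Conversely,
  by Menger's theorem, two such vertices lie on a common cycle, which has more than \<open>m\<close> vertices. So it
  can be decided in polynomial time whether such a pair exists, and if so the answer is yes.

  In the cases with answer yes, the output is a clique formed by the points \<open>(2\<^sup>-\<^sup>i, 0)\<close>.
\<close>

section \<open>Breadth-first search in a graph with deleted vertices\<close>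

section \<open>Neighbourhoods\<close>

text \<open>The machine cannot round reals, so the program has no grid: the squares it tests are
  centred at input points, and floors occur only in the counting argument. Its time is measured in
  the number of vertices, whereas \<open>k\<close> may be huge for Longest Cycle. Radii are
  therefore cut off at the number of points, and the loops that write \<open>m\<close> points run
  only in cases where \<open>m\<close> is known to be at most the input size plus 3.

  The obstacle for cycles is that, unlike a pattern, they have no bounded size: a graph may have a
  long cycle while every ball of radius \<open>m\<close> is acyclic. Such a cycle is detected
  through a far pair on it. Menger's theorem turns the search for two disjoint paths into
  reachability after each single vertex deletion, so a table of breadth-first searches replaces a
  flow algorithm. If no far pair exists, every cycle, of whatever length, lies in the ball around
  each of its vertices.

  The lower bound 3 in \<open>m\<close> lets a clique on \<open>m\<close> points carry a cycle.
  Powers of 1/2 are distinct points of the unit interval that arise by scaling with one rational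
  constant; no division by \<open>m\<close> is available.\<close>

primrec nbh :: "'a set set \<Rightarrow> 'a set \<Rightarrow> 'a \<Rightarrow> nat \<Rightarrow> 'a set" where
  "nbh E X p 0 = {p}"
| "nbh E X p (Suc t) = nbh E X p t \<union> {q. q \<notin> X \<and> (\<exists>b\<in>nbh E X p t. {b, q} \<in> E)}"

lemma nbh_mono: "t \<le> t' \<Longrightarrow> nbh E X p t \<subseteq> nbh E X p t'"
  by (rule lift_Suc_mono_le[of "nbh E X p"]) auto

lemma center_in_nbh: "p \<in> nbh E X p t"
  using nbh_mono[of 0 t E X p] by auto

lemma nbh_mono_edges: "E \<subseteq> E' \<Longrightarrow> nbh E X p t \<subseteq> nbh E' X p t"
  by (induction t) auto

lemma nbh_subset:
  assumes "\<forall>e\<in>E. e \<subseteq> V" "p \<in> V"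
  shows "nbh E X p t \<subseteq> V"
  using assms by (induction t) auto

text \<open>Before it stabilises, the neighbourhood gains a vertex in every round.\<close>

lemma nbh_stable:
  assumes "finite V" "\<forall>e\<in>E. e \<subseteq> V" "p \<in> V" "card V \<le> t"
  shows "nbh E X p (Suc t) = nbh E X p t"
proof -
  have fin: "finite (nbh E X p i)" and le: "card (nbh E X p i) \<le> card V" for i
    using nbh_subset[OF assms(2,3)] assms(1) by (auto intro: finite_subset card_mono)
  have "nbh E X p (Suc i) = nbh E X p i \<or> Suc i \<le> card (nbh E X p i)" for i
  proof (induction i)
    case 0
    then show ?case by simp
  next
    case (Suc i)
    show ?case
    proof (cases "nbh E X p (Suc i) = nbh E X p i")
      case True
      then have "nbh E X p (Suc (Suc i)) = nbh E X p (Suc i)"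
        by (simp only: nbh.simps(2)[of _ _ _ "Suc i"]) (use True in simp)
      then show ?thesis ..
    next
      case False
      then have "nbh E X p i \<subset> nbh E X p (Suc i)" by auto
      then have "card (nbh E X p i) < card (nbh E X p (Suc i))"
        by (rule psubset_card_mono[OF fin])
      then show ?thesis using Suc False by simp
    qed
  qed
  from this[of t] show ?thesis using assms(4) le[of t] by linarith
qed

text \<open>Both ends must avoid \<open>X\<close>, which makes the relation symmetric; the growth
  step of \<open>nbh\<close> checks only the new vertex.\<close>

definition link :: "'a set set \<Rightarrow> 'a set \<Rightarrow> 'a \<Rightarrow> 'a \<Rightarrow> bool" where
  "link E X a b \<longleftrightarrow> {a, b} \<in> E \<and> a \<notin> X \<and> b \<notin> X"

lemma link_empty: "link E {} = (\<lambda>a b. {a, b} \<in> E)"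
  by (simp add: link_def fun_eq_iff)

lemma link_sym: "link E X a b \<Longrightarrow> link E X b a"
  by (auto simp: link_def insert_commute)

lemma links_sym: "(link E X)\<^sup>*\<^sup>* a b \<Longrightarrow> (link E X)\<^sup>*\<^sup>* b a"
  by (induction rule: rtranclp_induct) (auto intro: link_sym converse_rtranclp_into_rtranclp)

text \<open>The start belongs to \<open>nbh\<close> even if it is deleted, whereas
  \<open>link\<close> excludes it; hence the assumption on \<open>p\<close>.\<close>

lemma nbh_links:
  assumes "p \<notin> X" "q \<in> nbh E X p t"
  shows "(link E X)\<^sup>*\<^sup>* p q"
proof -
  have "\<forall>q\<in>nbh E X p t. q \<notin> X \<and> (link E X)\<^sup>*\<^sup>* p q"
    by (induction t) (auto simp: assms(1) link_def intro: rtranclp.rtrancl_into_rtrancl)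
  then show ?thesis using assms(2) by blast
qed

text \<open>After \<open>card V\<close> rounds a further round adds nothing, so no walk, however
  long, can leave the neighbourhood.\<close>

lemma links_nbh:
  assumes "finite V" "\<forall>e\<in>E. e \<subseteq> V" "p \<in> V" "card V \<le> t" "(link E X)\<^sup>*\<^sup>* p q"
  shows "q \<in> nbh E X p t"
  using assms(5)
proof (induction rule: rtranclp_induct)
  case base
  then show ?case by (rule center_in_nbh)
next
  case (step y z)
  then have "z \<in> nbh E X p (Suc t)" by (auto simp: link_def)
  then show ?case using nbh_stable[OF assms(1-4)] by blast
qed

section \<open>Closed paths and Menger's theorem for two paths\<close>

section \<open>Cycles through two vertices\<close>

definition closed_path :: "'a set set \<Rightarrow> 'a list \<Rightarrow> bool" where
  "closed_path E vs \<longleftrightarrow>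
     2 \<le> length vs \<and> distinct vs \<and> successively (\<lambda>a b. {a, b} \<in> E) (vs @ [hd vs])"

lemma closed_path_nth:
  assumes "closed_path E vs" "i < length vs"
  shows "{vs ! i, vs ! ((i + 1) mod length vs)} \<in> E"
proof -
  have "{(vs @ [hd vs]) ! i, (vs @ [hd vs]) ! Suc i} \<in> E"
    using assms by (auto simp: closed_path_def successively_conv_nth)
  moreover have "vs \<noteq> []" using assms by auto
  ultimately show ?thesis using assms(2)
    by (cases "Suc i = length vs") (auto simp: nth_append hd_conv_nth)
qed

lemma closed_pathI_nth:
  assumes "2 \<le> length vs" "distinct vs"
    "\<forall>i<length vs. {vs ! i, vs ! ((i + 1) mod length vs)} \<in> E"
  shows "closed_path E vs"
proof -
  have "{(vs @ [hd vs]) ! i, (vs @ [hd vs]) ! Suc i} \<in> E" if "i < length vs" for i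
  proof (cases "Suc i = length vs")
    case True
    then have "vs \<noteq> []" by auto
    then show ?thesis using assms(3)[rule_format, OF that] True that
      by (auto simp: nth_append hd_conv_nth)
  next
    case False
    then show ?thesis using assms(3)[rule_format, OF that] that
      by (auto simp: nth_append)
  qed
  then show ?thesis using assms(1,2) by (auto simp: closed_path_def successively_conv_nth)
qed

lemma cycle_closed_path:
  "cycle G vs \<longleftrightarrow> closed_path (edges G) vs \<and> 3 \<le> length vs \<and> set vs \<subseteq> verts G"
proof
  assume "cycle G vs"
  then show "closed_path (edges G) vs \<and> 3 \<le> length vs \<and> set vs \<subseteq> verts G"
    by (auto simp: cycle_def intro: closed_pathI_nth)
next
  assume *: "closed_path (edges G) vs \<and> 3 \<le> length vs \<and> set vs \<subseteq> verts G"
  then have "\<forall>i<length vs. {vs ! i, vs ! ((i + 1) mod length vs)} \<in> edges G"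
    using closed_path_nth by blast
  then show "cycle G vs" using * by (auto simp: cycle_def closed_path_def)
qed

lemma closed_path_swap:
  assumes "closed_path E (as @ bs)"
  shows "closed_path E (bs @ as)"
  using assms by (cases as; cases bs)
    (auto simp: closed_path_def successively_append_iff successively_Cons hd_append split: if_splits)

lemma closed_path_start_at:
  assumes "closed_path E vs" "v \<in> set vs"
  obtains ws where "closed_path E (v # ws)" "set (v # ws) = set vs"
proof -
  obtain as bs where "vs = as @ v # bs" using assms(2) by (meson split_list)
  then show ?thesis
    using closed_path_swap[of E as "v # bs"] assms(1) that[of "bs @ as"] by auto
qed

lemma closed_path_rev:
  assumes "closed_path E (v # ws)"
  shows "closed_path E (v # rev ws)"
proof -
  have "successively (\<lambda>a b. {a, b} \<in> E) (rev (v # ws @ [v]))"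
    using assms by (subst successively_rev) (simp add: closed_path_def insert_commute)
  then show ?thesis using assms by (simp add: closed_path_def)
qed

text \<open>The walk is processed from its end. Prepending \<open>y\<close> gives a one-vertex path
  if \<open>y\<close> is in \<open>C\<close>, cuts the path short if \<open>y\<close> already occurs
  on it, and extends it otherwise. The path thus stops at its first vertex in
  \<open>C\<close>.\<close>

lemma path_to_set:
  assumes "(link E X)\<^sup>*\<^sup>* q u" "u \<in> C" "q \<notin> X"
  obtains zs where "successively (\<lambda>a b. {a, b} \<in> E) zs" "zs \<noteq> []" "hd zs = q" "distinct zs"
    "last zs \<in> C" "set (butlast zs) \<inter> C = {}" "set zs \<inter> X = {}"
proof -
  have "q \<notin> X \<longrightarrow> (\<exists>zs. successively (\<lambda>a b. {a, b} \<in> E) zs \<and> zs \<noteq> [] \<and> hd zs = q \<and> distinct zs \<and>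
    last zs \<in> C \<and> set (butlast zs) \<inter> C = {} \<and> set zs \<inter> X = {})"
    using assms(1)
  proof (induction rule: converse_rtranclp_induct)
    case base
    then show ?case using assms(2) by (auto intro!: exI[of _ "[u]"])
  next
    case (step y z)
    then obtain zs where zs: "successively (\<lambda>a b. {a, b} \<in> E) zs" "zs \<noteq> []" "hd zs = z" "distinct zs"
      "last zs \<in> C" "set (butlast zs) \<inter> C = {}" "set zs \<inter> X = {}" and yz: "{y, z} \<in> E" "y \<notin> X"
      by (auto simp: link_def)
    consider "y \<in> C" | "y \<in> set zs" | "y \<notin> C" "y \<notin> set zs" by blast
    then show ?case
    proof cases
      case 1
      then show ?thesis using yz by (auto intro!: exI[of _ "[y]"])
    next
      case 2
      then obtain as bs where "zs = as @ y # bs" by (meson split_list)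
      then show ?thesis using zs
        by (auto intro!: exI[of _ "y # bs"] simp: successively_append_iff butlast_append split: if_splits)
    next
      case 3
      then show ?thesis using zs yz
        by (auto intro!: exI[of _ "y # zs"] simp: successively_Cons)
    qed
  qed
  then show ?thesis using assms(3) that by blast
qed

text \<open>
  A closed path through \<open>u\<close> and \<open>v\<close> is rerouted through a neighbour \<open>q\<close> of \<open>v\<close>: follow a path
  from \<open>q\<close> that avoids \<open>v\<close> up to the first vertex on the closed path, and return to \<open>v\<close> along
  the arc that contains \<open>u\<close>.
\<close>

lemma closed_path_extend:
  assumes vs: "closed_path E vs" "u \<in> set vs" "v \<in> set vs" "u \<noteq> v"
    and q: "{v, q} \<in> E" "q \<noteq> v" "(link E {v})\<^sup>*\<^sup>* q u"
  obtains ws where "closed_path E ws" "u \<in> set ws" "q \<in> set ws"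
proof (cases "q \<in> set vs")
  case True
  then show ?thesis using that vs by blast
next
  case False
  obtain xs where xs: "closed_path E (v # xs)" "set (v # xs) = set vs"
    using closed_path_start_at vs by metis
  obtain zs where zs: "successively (\<lambda>a b. {a, b} \<in> E) zs" "zs \<noteq> []" "hd zs = q" "distinct zs"
    "last zs \<in> set vs" "set (butlast zs) \<inter> set vs = {}" "set zs \<inter> {v} = {}"
    using path_to_set[OF q(3) vs(2)] q(2) by auto
  \<comment> \<open>\<open>y\<close> is where the detour lands on the closed path; \<open>ys\<close>
    is the part strictly off it.\<close>
  obtain ys y where zs_eq: "zs = ys @ [y]" using zs(2) by (cases zs rule: rev_cases) auto
  define cs where "cs = rev ys"
  have y: "y \<in> set vs" "y \<noteq> v" and ys: "set ys \<inter> set vs = {}" "v \<notin> set ys"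
    using zs(5-7) by (auto simp: zs_eq)
  have "ys \<noteq> []" using zs(3) y(1) False by (auto simp: zs_eq)
  then have cs: "cs \<noteq> []" "last cs = q" using zs(3) by (auto simp: cs_def zs_eq last_rev)
  have "y \<in> set xs" using y xs(2) by auto
  have u_in: "u \<in> set xs" using vs xs(2) by auto
  \<comment> \<open>The closed path is reversed if necessary, so that \<open>u\<close> lies on the
    arc from \<open>v\<close> to \<open>y\<close>.\<close>
  obtain xs' as bs where c: "closed_path E (v # xs')" "set xs' = set xs"
    "xs' = as @ y # bs" "u \<in> set (as @ [y])"
  proof -
    obtain as bs where ab: "xs = as @ y # bs" using \<open>y \<in> set xs\<close> by (meson split_list)
    show ?thesis
    proof (cases "u \<in> set (as @ [y])")
      case True
      then show ?thesis using that[of xs as bs] xs ab by auto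
    next
      case False
      then show ?thesis
        using that[of "rev xs" "rev bs" "rev as"] closed_path_rev[OF xs(1)] ab u_in by auto
    qed
  qed
  \<comment> \<open>From \<open>v\<close> along the arc through \<open>u\<close> to
    \<open>y\<close>, then backwards along the detour to \<open>q\<close>; the edge between
    \<open>q\<close> and \<open>v\<close> closes it.\<close>
  let ?ws = "v # as @ y # cs"
  have "successively (\<lambda>a b. {a, b} \<in> E) (y # cs)"
  proof -
    have "successively (\<lambda>a b. {a, b} \<in> E) (rev zs)"
      using zs(1) by (subst successively_rev) (simp add: insert_commute)
    then show ?thesis by (simp add: zs_eq cs_def)
  qed
  then have "successively (\<lambda>a b. {a, b} \<in> E) (?ws @ [v])"
    using c(1,3) cs q(1) unfolding closed_path_def
    by (auto simp: successively_append_iff successively_Cons insert_commute hd_append split: if_splits)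
  moreover have "distinct ?ws"
    using c(1-3) xs(2) zs(4) ys unfolding closed_path_def cs_def zs_eq by auto
  ultimately have "closed_path E ?ws" by (simp add: closed_path_def)
  moreover have "u \<in> set ?ws" "q \<in> set ?ws" using c(4) cs by auto
  ultimately show ?thesis by (rule that)
qed

text \<open>Menger's theorem for two paths.\<close>

lemma closed_path_if_not_separated:
  assumes ne: "u \<noteq> w" and con: "(link E {})\<^sup>*\<^sup>* u w"
    and sep: "\<And>x. x \<noteq> u \<Longrightarrow> x \<noteq> w \<Longrightarrow> (link E {x})\<^sup>*\<^sup>* u w"
  obtains vs where "closed_path E vs" "u \<in> set vs" "w \<in> set vs"
proof -
  obtain zs where zs: "successively (\<lambda>a b. {a, b} \<in> E) zs" "zs \<noteq> []" "hd zs = u" "distinct zs"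
    "last zs = w"
    using path_to_set[OF con, of "{w}"] by auto
  \<comment> \<open>A stretch of the path that misses \<open>x\<close> connects its ends after the
    deletion of \<open>x\<close>.\<close>
  have sub: "(link E {x})\<^sup>*\<^sup>* (zs ! i) (zs ! j)"
    if "i \<le> j" "j < length zs" "\<And>l. i \<le> l \<Longrightarrow> l \<le> j \<Longrightarrow> zs ! l \<noteq> x" for i j x
    using that
  proof (induction j rule: dec_induct)
    case base
    then show ?case by simp
  next
    case (step n)
    then have "link E {x} (zs ! n) (zs ! Suc n)"
      using zs(1) by (auto simp: link_def successively_conv_nth)
    moreover have "(link E {x})\<^sup>*\<^sup>* (zs ! i) (zs ! n)" using step by simp
    ultimately show ?case by simp
  qed
  have z0: "zs ! 0 = u" using zs(2,3) by (simp add: hd_conv_nth)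
  have zl: "zs ! (length zs - 1) = w" using zs(2,5) by (simp add: last_conv_nth)
  have len: "2 \<le> length zs" using zs(2,3,5) ne by (cases zs rule: remdups_adj.cases) auto
  \<comment> \<open>The closed path is moved along \<open>zs\<close>: it always contains
    \<open>u\<close>, and its second prescribed vertex advances by one until it is
    \<open>w\<close>.\<close>
  have "\<exists>vs. closed_path E vs \<and> u \<in> set vs \<and> zs ! Suc i \<in> set vs" if "Suc i < length zs" for i
    using that
  proof (induction i)
    case 0
    have "{zs ! 0, zs ! 1} \<in> E" using zs(1) 0 by (auto simp: successively_conv_nth)
    then have "closed_path E [zs ! 0, zs ! 1]"
      using 0 zs(2) nth_eq_iff_index_eq[OF zs(4), of 0 1]
      by (simp add: closed_path_def insert_commute)
    then show ?case using z0 by (auto intro!: exI[of _ "[zs ! 0, zs ! 1]"])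
  next
    case (Suc i)
    then obtain vs where vs: "closed_path E vs" "u \<in> set vs" "zs ! Suc i \<in> set vs" by auto
    let ?v = "zs ! Suc i" and ?q = "zs ! Suc (Suc i)"
    have dist: "zs ! a = zs ! b \<longleftrightarrow> a = b" if "a < length zs" "b < length zs" for a b
      using that zs(4) by (simp add: nth_eq_iff_index_eq)
    have "u \<noteq> ?v" "?v \<noteq> w" "?q \<noteq> ?v"
      using dist[of 0 "Suc i"] dist[of "Suc i" "length zs - 1"] dist[of "Suc i" "Suc (Suc i)"] z0 zl zs(2)
        Suc.prems
      by auto
    have "(link E {?v})\<^sup>*\<^sup>* ?q w"
      \<comment> \<open>The rest of \<open>zs\<close> never returns to \<open>?v\<close>, so
        \<open>?q\<close> still reaches \<open>w\<close>; from there the separation assumption leads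
        back to \<open>u\<close>. This is the walk that \<open>closed_path_extend\<close> asks
        for.\<close>
      using sub[of "Suc (Suc i)" "length zs - 1" ?v] Suc.prems zl dist by fastforce
    moreover have "(link E {?v})\<^sup>*\<^sup>* w u"
      using sep[of ?v] \<open>u \<noteq> ?v\<close> \<open>?v \<noteq> w\<close> links_sym by metis
    ultimately have "(link E {?v})\<^sup>*\<^sup>* ?q u" by simp
    moreover have "{?v, ?q} \<in> E" using zs(1) Suc.prems by (auto simp: successively_conv_nth)
    ultimately show ?case
      using closed_path_extend[OF vs \<open>u \<noteq> ?v\<close>] \<open>?q \<noteq> ?v\<close> by metis
  qed
  moreover have "Suc (length zs - 2) = length zs - 1" using len by simp
  ultimately show ?thesis using len zl that by (metis diff_less le_eq_less_or_eq less_numeral_extra(1) order_less_le_trans pos2)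
qed

lemma closed_path_prefix_links:
  assumes "successively (\<lambda>a b. {a, b} \<in> E) (u # ws)" "set (u # ws) \<inter> X = {}" "y \<in> set (u # ws)"
  shows "(link E X)\<^sup>*\<^sup>* u y"
  using assms
proof (induction ws arbitrary: u)
  case Nil
  then show ?case by simp
next
  case (Cons a ws)
  then have "link E X u a" by (simp add: link_def)
  moreover have "y = u \<or> (link E X)\<^sup>*\<^sup>* a y" using Cons.IH[of a] Cons.prems by auto
  ultimately show ?case by (auto intro: converse_rtranclp_into_rtranclp)
qed

text \<open>Deleting \<open>x\<close> leaves the two arcs from \<open>u\<close> towards
  \<open>x\<close>, and \<open>w\<close> lies on one of them. Taking \<open>X\<close> as a subset of
  \<open>{x}\<close> also covers the case without deletion.\<close>

lemma closed_path_not_separated: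
  assumes "closed_path E vs" "u \<in> set vs" "w \<in> set vs" "u \<notin> X" "w \<notin> X" "X \<subseteq> {x}"
  shows "(link E X)\<^sup>*\<^sup>* u w"
proof -
  obtain ws where ws: "closed_path E (u # ws)" "set (u # ws) = set vs"
    using closed_path_start_at assms by metis
  have succ: "successively (\<lambda>a b. {a, b} \<in> E) (u # ws @ [u])" "distinct (u # ws)"
    using ws(1) by (auto simp: closed_path_def)
  show ?thesis
  proof (cases "set (u # ws) \<inter> X = {}")
    case True
    have "successively (\<lambda>a b. {a, b} \<in> E) (u # ws)"
      using succ(1) by (metis append_Cons successively_append_iff)
    then show ?thesis using closed_path_prefix_links True ws(2) assms(3) by metis
  next
    case False
    then have X: "X = {x}" "x \<in> set ws" using assms(4,6) by auto
    then obtain as bs where ab: "ws = as @ x # bs" by (meson split_list)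
    have s1: "successively (\<lambda>a b. {a, b} \<in> E) (u # as)"
      using succ(1) unfolding ab by (auto simp add: successively_append_iff successively_Cons hd_append split: if_splits)
    have "successively (\<lambda>a b. {a, b} \<in> E) (bs @ [u])"
      using succ(1) unfolding ab by (auto simp add: successively_append_iff successively_Cons)
    then have s2: "successively (\<lambda>a b. {a, b} \<in> E) (u # rev bs)"
      using successively_rev[of _ "bs @ [u]"] by (simp add: insert_commute)
    have "w \<in> set (u # as) \<or> w \<in> set (u # rev bs)" using assms(3,5) ws(2) X ab by auto
    moreover have "set (u # as) \<inter> X = {}" "set (u # rev bs) \<inter> X = {}"
      using succ(2) X(1) unfolding ab by auto
    ultimately show ?thesis using closed_path_prefix_links s1 s2 by metis
  qed
qed

text \<open>Used in contrapositive form: a closed path through \<open>u\<close> that leaves the ball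
  of radius \<open>t\<close> has more than \<open>t + 1\<close> vertices.\<close>

lemma closed_path_subset_nbh:
  assumes "closed_path E vs" "u \<in> set vs" "length vs \<le> t + 1"
  shows "set vs \<subseteq> nbh E {} u t"
proof -
  obtain ws where ws: "closed_path E (u # ws)" "set (u # ws) = set vs"
    using closed_path_start_at assms by metis
  have len: "length (u # ws) = length vs"
    using ws assms(1) by (metis closed_path_def distinct_card)
  have "(u # ws) ! i \<in> nbh E {} u i" if "i < length (u # ws)" for i
    using that
  proof (induction i)
    case 0
    then show ?case by simp
  next
    case (Suc i)
    then have "{(u # ws) ! i, (u # ws) ! Suc i} \<in> E"
      using closed_path_nth[OF ws(1), of i] by simp
    then show ?case using Suc by auto
  qed
  moreover have "nbh E {} u i \<subseteq> nbh E {} u t" if "i < length (u # ws)" for i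
    using that len assms(3) by (intro nbh_mono) linarith
  ultimately show ?thesis unfolding ws(2)[symmetric] by (metis in_set_conv_nth subset_iff)
qed

section \<open>Counting points in squares and in balls of the graph\<close>

section \<open>Geometry\<close>

text \<open>The maximum metric treats both shapes alike: adjacency lies between
  \<open>near 1\<close> and \<open>near 2\<close>.\<close>

definition near :: "real \<Rightarrow> point \<Rightarrow> point \<Rightarrow> bool" where
  "near d p q \<longleftrightarrow> \<bar>fst p - fst q\<bar> \<le> d \<and> \<bar>snd p - snd q\<bar> \<le> d"

lemma close_imp_near: "close s p q \<Longrightarrow> near 2 p q"
proof (induction s p q rule: close.induct)
  case (1 x y x' y')
  have "\<bar>x - x'\<bar> \<le> sqrt ((x - x')\<^sup>2 + (y - y')\<^sup>2)" "\<bar>y - y'\<bar> \<le> sqrt ((x - x')\<^sup>2 + (y - y')\<^sup>2)"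
    by (rule real_le_rsqrt; simp)+
  moreover have "sqrt ((x - x')\<^sup>2 + (y - y')\<^sup>2) \<le> 2" using 1 by simp
  ultimately show ?case unfolding near_def fst_conv snd_conv by linarith
qed (auto simp: near_def)

lemma near_imp_close: "near 1 p q \<Longrightarrow> close s p q"
proof (induction s p q rule: close.induct)
  case (1 x y x' y')
  have "(x - x')\<^sup>2 \<le> 1" "(y - y')\<^sup>2 \<le> 1"
    using 1 by (auto simp: near_def abs_square_le_1)
  then have "sqrt ((x - x')\<^sup>2 + (y - y')\<^sup>2) \<le> sqrt (2\<^sup>2)"
    by (intro real_sqrt_le_mono) (auto simp: power2_eq_square)
  then show ?case by simp
qed (auto simp: near_def)

lemma close_commute: "close s p q \<longleftrightarrow> close s q p"
  by (cases s; cases p; cases q) (simp_all add: abs_minus_commute power2_commute)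

lemma verts_geometric_graph [simp]: "verts (geometric_graph s P) = P"
  by (simp add: geometric_graph_def)

lemma edge_geometric_graph:
  "{p, q} \<in> edges (geometric_graph s P) \<longleftrightarrow> p \<in> P \<and> q \<in> P \<and> p \<noteq> q \<and> close s p q"
  unfolding geometric_graph_def snd_conv mem_Collect_eq doubleton_eq_iff using close_commute by blast

lemma edges_geometric_graphD:
  assumes "e \<in> edges (geometric_graph s P)"
  obtains p q where "e = {p, q}" "p \<in> P" "q \<in> P" "p \<noteq> q" "close s p q"
  using assms by (auto simp: geometric_graph_def)

lemma edges_geometric_graph_subset: "\<forall>e\<in>edges (geometric_graph s P). e \<subseteq> P"
  by (auto elim!: edges_geometric_graphD)

lemma edges_geometric_graph_mono:
  "B \<subseteq> P \<Longrightarrow> edges (geometric_graph s B) \<subseteq> edges (geometric_graph s P)"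
  unfolding geometric_graph_def snd_conv by blast

text \<open>The radius is 1/2 because two points within 1/2 of \<open>p\<close> are within 1 of each
  other and hence adjacent for both shapes.\<close>

definition dense_pt :: "nat \<Rightarrow> point set \<Rightarrow> point \<Rightarrow> bool" where
  "dense_pt m P p \<longleftrightarrow> m \<le> card {q \<in> P. near (1/2) p q}"

text \<open>
  A box of side \<open>2 D\<close> is covered by \<open>(4 D + 1)\<^sup>2\<close> boxes of side \<open>1/2\<close>, and a box of side
  \<open>1/2\<close> around a point \<open>p\<close> contains less than \<open>m\<close> points unless \<open>p\<close> is dense.
\<close>

lemma card_near_le:
  assumes fin: "finite P" and sparse: "\<And>p. p \<in> P \<Longrightarrow> \<not> dense_pt m P p"
  shows "card {q \<in> P. near (real D) p q} \<le> (4 * D + 1)\<^sup>2 * m"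
proof -
  let ?N = "{q \<in> P. near (real D) p q}"
  \<comment> \<open>Doubling before taking floors gives half-open cells of side 1/2 with indices
    from \<open>- 2 * D\<close> to \<open>2 * D\<close> on each axis.\<close>
  define cell where "cell q = (\<lfloor>2 * (fst q - fst p)\<rfloor>, \<lfloor>2 * (snd q - snd p)\<rfloor>)" for q
  define C where "C = {- 2 * int D..2 * int D} \<times> {- 2 * int D..2 * int D}"
  have bnd: "\<lfloor>2 * x\<rfloor> \<in> {- 2 * int D..2 * int D}" if "\<bar>x\<bar> \<le> real D" for x
    using that by (simp add: le_floor_iff floor_le_iff abs_le_iff)
  have "?N \<subseteq> (\<Union>c\<in>C. {q \<in> ?N. cell q = c})"
  proof
    fix q assume q: "q \<in> ?N"
    then have "cell q \<in> C"
      using bnd[of "fst q - fst p"] bnd[of "snd q - snd p"]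
      by (simp add: C_def cell_def near_def abs_minus_commute)
    then show "q \<in> (\<Union>c\<in>C. {q \<in> ?N. cell q = c})" using q by blast
  qed
  then have "card ?N \<le> card (\<Union>c\<in>C. {q \<in> ?N. cell q = c})"
    using fin by (intro card_mono) (auto simp: C_def)
  also have "\<dots> \<le> (\<Sum>c\<in>C. card {q \<in> ?N. cell q = c})"
    by (rule card_UN_le) (simp add: C_def)
  also have "\<dots> \<le> (\<Sum>c\<in>C. m)"
  proof (rule sum_mono)
    fix c assume "c \<in> C"
    show "card {q \<in> ?N. cell q = c} \<le> m"
    proof (cases "{q \<in> ?N. cell q = c} = {}")
      case True
      show ?thesis unfolding True by simp
    next
      case False
      \<comment> \<open>Any point of \<open>P\<close> in the cell can serve as the centre: the whole
        cell lies within 1/2 of it, and it is not dense.\<close>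
      then obtain q where q: "q \<in> P" "cell q = c" by auto
      have "{q \<in> ?N. cell q = c} \<subseteq> {q' \<in> P. near (1/2) q q'}"
      proof safe
        fix a b assume ab: "(a, b) \<in> P" "c = cell (a, b)"
        have "\<bar>u - v\<bar> < 1" if "\<lfloor>u\<rfloor> = \<lfloor>v\<rfloor>" for u v :: real
          using that by linarith
        from this[of "2 * (x - z)" "2 * (y - z)" for x y z]
        have "\<bar>x - y\<bar> \<le> 1/2" if "\<lfloor>2 * (x - z)\<rfloor> = \<lfloor>2 * (y - z)\<rfloor>" for x y z :: real
          using that by (smt (verit) field_sum_of_halves)
        from this[where z = "fst p"] this[where z = "snd p"] show "near (1/2) q (a, b)"
          using q(2) ab(2) unfolding cell_def near_def fst_conv snd_conv by blast
      qed
      then have "card {q \<in> ?N. cell q = c} \<le> card {q' \<in> P. near (1/2) q q'}"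
        using fin by (intro card_mono) auto
      then show ?thesis using sparse[OF q(1)] by (simp add: dense_pt_def)
    qed
  qed
  also have "\<dots> = (4 * D + 1)\<^sup>2 * m"
    by (simp add: C_def power2_eq_square nat_add_distrib nat_mult_distrib)
  finally show ?thesis .
qed

lemma nbh_near:
  assumes "q \<in> nbh (edges (geometric_graph s P)) X p t"
  shows "near (real (2 * t)) p q"
  using assms
proof (induction t arbitrary: q)
  case 0
  then show ?case by (simp add: near_def)
next
  case (Suc t)
  show ?case
  proof (cases "q \<in> nbh (edges (geometric_graph s P)) X p t")
    case True
    then show ?thesis using Suc.IH[of q] by (simp add: near_def)
  next
    case False
    then obtain b where "b \<in> nbh (edges (geometric_graph s P)) X p t" "close s b q"
      using Suc.prems by (auto simp: edge_geometric_graph)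
    then have "near (real (2 * t)) p b" "near 2 b q" using Suc.IH close_imp_near by blast+
    moreover have "real (2 * Suc t) = real (2 * t) + 2" by simp
    ultimately show ?thesis unfolding near_def by (elim conjE, intro conjI; linarith)
  qed
qed

text \<open>An edge spans at most 2 in each coordinate, so the ball lies in a square of half-side
  \<open>2 * r\<close>, and \<open>8 * r + 1 \<le> 9 * m\<close>.\<close>

lemma card_nbh_le:
  assumes fin: "finite P" and sparse: "\<And>p. p \<in> P \<Longrightarrow> \<not> dense_pt m P p"
    and "p \<in> P" "r \<le> m" "0 < m"
  shows "card (nbh (edges (geometric_graph s P)) X p r) \<le> 81 * m ^ 3"
proof -
  have "nbh (edges (geometric_graph s P)) X p r \<subseteq> {q \<in> P. near (real (2 * r)) p q}"
    using nbh_near nbh_subset[OF edges_geometric_graph_subset \<open>p \<in> P\<close>] by blast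
  then have "card (nbh (edges (geometric_graph s P)) X p r) \<le> card {q \<in> P. near (real (2 * r)) p q}"
    using fin by (intro card_mono) auto
  also have "\<dots> \<le> (4 * (2 * r) + 1)\<^sup>2 * m" by (rule card_near_le[OF fin sparse])
  also have "\<dots> \<le> (9 * m)\<^sup>2 * m"
    using assms(4,5) by (intro mult_right_mono power_mono) auto
  finally show ?thesis by (simp add: power2_eq_square power3_eq_cube)
qed

text \<open>A neighbour differs by at most 2 in each coordinate; half-side 2 gives
  \<open>(4 * 2 + 1)^2 = 81\<close> cells, hence degrees of at most \<open>81 * m\<close>.\<close>

lemma card_edges_le:
  assumes fin: "finite P" and sparse: "\<And>p. p \<in> P \<Longrightarrow> \<not> dense_pt m P p" and "B \<subseteq> P"
  shows "card (edges (geometric_graph s B)) \<le> card B * (81 * m)"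
proof -
  let ?N = "\<lambda>p. (\<lambda>q. {p, q}) ` {q \<in> P. near (real 2) p q}"
  have finN: "finite (?N p)" for p using fin by auto
  have "edges (geometric_graph s B) \<subseteq> (\<Union>p\<in>B. ?N p)"
    using \<open>B \<subseteq> P\<close> by (fastforce elim!: edges_geometric_graphD dest: close_imp_near)
  moreover have "finite B" using \<open>B \<subseteq> P\<close> fin finite_subset by blast
  ultimately have "card (edges (geometric_graph s B)) \<le> card (\<Union>p\<in>B. ?N p)"
    using finN by (intro card_mono) auto
  also have "\<dots> \<le> (\<Sum>p\<in>B. card (?N p))" using \<open>finite B\<close> by (rule card_UN_le)
  also have "\<dots> \<le> (\<Sum>p\<in>B. 81 * m)"
  proof (rule sum_mono)
    fix p
    have "card (?N p) \<le> card {q \<in> P. near (real 2) p q}" using fin by (intro card_image_le) auto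
    then show "card (?N p) \<le> 81 * m" using card_near_le[OF fin sparse, of 2 p] by simp
  qed
  finally show ?thesis by simp
qed

section \<open>Patterns and cycles inside large cliques\<close>

section \<open>Cliques\<close>

text \<open>Any injection of the vertices of \<open>H\<close> into a clique carries \<open>H\<close>
  to a subgraph. The empty clique is allowed and serves patterns without vertices.\<close>

lemma clique_subgraph:
  assumes H: "simple_graph H" "card (verts H) \<le> card C"
    and C: "finite C" "C \<subseteq> P" "\<And>p q. p \<in> C \<Longrightarrow> q \<in> C \<Longrightarrow> close s p q"
  shows "\<exists>S. subgraph S (geometric_graph s P) \<and> isomorphic S H"
proof -
  have fin: "finite (verts H)" using H by (simp add: simple_graph_def)
  obtain f where f: "inj_on f (verts H)" "f ` verts H \<subseteq> C"
    using card_le_inj[OF fin C(1) H(2)] by auto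
  define S where "S = (f ` verts H, (`) f ` edges H)"
  have edgeH: "e \<subseteq> verts H" "\<exists>u v. e = {u, v} \<and> u \<noteq> v" if "e \<in> edges H" for e
    using H(1) that by (auto simp: simple_graph_def card_2_iff)
  have "card (f ` e) = 2" if "e \<in> edges H" for e
    using H(1) that f(1) by (metis card_image inj_on_subset simple_graph_def)
  then have "simple_graph S"
    using fin edgeH(1) by (auto simp: simple_graph_def S_def)
  moreover have "edges S \<subseteq> edges (geometric_graph s P)"
  proof
    fix e assume "e \<in> edges S"
    then obtain e' where e': "e' \<in> edges H" "e = f ` e'" by (auto simp: S_def)
    then obtain u v where uv: "e' = {u, v}" "u \<noteq> v" "u \<in> verts H" "v \<in> verts H"
      using edgeH by blast
    then have "f u \<noteq> f v" using f(1) by (auto dest: inj_onD)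
    then show "e \<in> edges (geometric_graph s P)"
      using uv e'(2) by (simp add: edge_geometric_graph) (use f(2) C(2,3) in blast)
  qed
  ultimately have "subgraph S (geometric_graph s P)"
    using f(2) C(2) by (auto simp: subgraph_def S_def)
  moreover have "isomorphic S H"
  proof -
    let ?g = "inv_into (verts H) f"
    have "bij_betw ?g (verts S) (verts H)"
      unfolding S_def fst_conv by (rule bij_betw_inv_into) (simp add: bij_betw_def f(1))
    moreover have "?g ` f ` e = e" if "e \<in> edges H" for e
      using edgeH(1)[OF that] f(1) by (simp add: inv_into_image_cancel)
    then have "(\<lambda>e. ?g ` e) ` edges S = edges H"
      by (auto simp: S_def image_iff)
    ultimately show ?thesis by (auto simp: isomorphic_def)
  qed
  ultimately show ?thesis by blast
qed

lemma clique_cycle: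
  assumes C: "finite C" "C \<subseteq> P" "\<And>p q. p \<in> C \<Longrightarrow> q \<in> C \<Longrightarrow> close s p q" and "3 \<le> card C"
  shows "\<exists>vs. cycle (geometric_graph s P) vs \<and> length vs = card C"
proof -
  obtain vs where vs: "set vs = C" "distinct vs" using finite_distinct_list C(1) by auto
  have len: "length vs = card C" using vs distinct_card by metis
  have "{vs ! i, vs ! ((i + 1) mod length vs)} \<in> edges (geometric_graph s P)"
    if "i < length vs" for i
  proof -
    have lt: "(i + 1) mod length vs < length vs" using that by (intro mod_less_divisor) linarith
    have "i \<noteq> (i + 1) mod length vs"
      using that len assms(4) by (cases "i + 1 = length vs") auto
    then have "vs ! i \<noteq> vs ! ((i + 1) mod length vs)"
      using vs(2) that lt by (simp add: nth_eq_iff_index_eq)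
    moreover have "vs ! i \<in> C" "vs ! ((i + 1) mod length vs) \<in> C"
      using vs(1) that lt nth_mem by blast+
    ultimately show ?thesis using C by (auto simp: edge_geometric_graph)
  qed
  then have "cycle (geometric_graph s P) vs"
    using vs len assms(4) C(2) by (auto simp: cycle_def)
  then show ?thesis using len by blast
qed

lemma dense_pt_clique:
  assumes "dense_pt m P p"
  shows "m \<le> card {q \<in> P. near (1/2) p q}"
    and "q \<in> {q \<in> P. near (1/2) p q} \<Longrightarrow> q' \<in> {q \<in> P. near (1/2) p q} \<Longrightarrow> close s q q'"
proof -
  show "m \<le> card {q \<in> P. near (1/2) p q}" using assms by (simp add: dense_pt_def)
  assume "q \<in> {q \<in> P. near (1/2) p q}" "q' \<in> {q \<in> P. near (1/2) p q}"
  then have "near 1 q q'"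
    unfolding near_def mem_Collect_eq by (elim conjE, intro conjI; linarith)
  then show "close s q q'" by (rule near_imp_close)
qed

lemma yes_if_dense:
  assumes inst: "is_instance prob s (G, P, H, k)" and "dense_pt m P p" "k \<le> int m" "3 \<le> m"
  shows "yes_instance prob (G, P, H, k)"
proof -
  let ?C = "{q \<in> P. near (1/2) p q}"
  have fin: "finite P" and G: "G = geometric_graph s P"
    using inst by (cases prob; simp)+
  note cl = dense_pt_clique[OF assms(2)]
  show ?thesis
  proof (cases prob)
    case Subgraph_Isomorphism
    then show ?thesis
      using inst clique_subgraph[of H ?C P s] cl fin assms(3) G by auto
  next
    case Longest_Cycle
    then show ?thesis
      using clique_cycle[of ?C P s] cl fin assms(3,4) G by fastforce
  qed
qed

section \<open>Confining patterns and cycles to balls\<close>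

section \<open>Small neighbourhoods\<close>

text \<open>Needed because instances of Subgraph Isomorphism have connected host graphs. A vertex
  added in some round is joined to one of the previous round, and that edge survives in the induced
  graph.\<close>

lemma connected_geometric_nbh:
  assumes "p \<in> P"
  shows "connected_graph (geometric_graph s (nbh (edges (geometric_graph s P)) {} p t))"
proof -
  let ?B = "nbh (edges (geometric_graph s P)) {} p"
  let ?R = "\<lambda>t. link (edges (geometric_graph s (?B t))) {}"
  have mono: "(?R t)\<^sup>*\<^sup>* a b \<Longrightarrow> (?R (Suc t))\<^sup>*\<^sup>* a b" for t a b
    by (rule rtranclp_mono[THEN predicate2D])
      (use edges_geometric_graph_mono[of "?B t" "?B (Suc t)" s] in \<open>auto simp: link_def\<close>)
  have reach: "\<forall>q\<in>?B t. (?R t)\<^sup>*\<^sup>* p q"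
  proof (induction t)
    case 0
    then show ?case by simp
  next
    case (Suc t)
    show ?case
    proof
      fix q assume q: "q \<in> ?B (Suc t)"
      show "(?R (Suc t))\<^sup>*\<^sup>* p q"
      proof (cases "q \<in> ?B t")
        case True
        then show ?thesis using Suc mono by blast
      next
        case False
        then obtain b where b: "b \<in> ?B t" "{b, q} \<in> edges (geometric_graph s P)" using q by auto
        then have "?R (Suc t) b q" using q by (auto simp: link_def edge_geometric_graph)
        then show ?thesis using Suc mono b(1) by (meson rtranclp.rtrancl_into_rtrancl)
      qed
    qed
  qed
  have "(?R t)\<^sup>*\<^sup>* u v" if "u \<in> ?B t" "v \<in> ?B t" for u v
  proof -
    have "(?R t)\<^sup>*\<^sup>* u p" by (rule links_sym) (use reach that(1) in blast)
    also have "(?R t)\<^sup>*\<^sup>* p v" using reach that(2) by blast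
    finally show ?thesis .
  qed
  then show ?thesis by (simp add: connected_graph_def link_empty)
qed

lemma subgraph_trans_geometric:
  "B \<subseteq> P \<Longrightarrow> subgraph S (geometric_graph s B) \<Longrightarrow> subgraph S (geometric_graph s P)"
  using edges_geometric_graph_mono[of B P s] by (auto simp: subgraph_def)

text \<open>The graph defined by \<open>B\<close> is the subgraph of that of \<open>P\<close>
  induced by \<open>B\<close>, so no edge between its points is lost.\<close>

lemma subgraph_restrict_geometric:
  assumes "subgraph S (geometric_graph s P)" "verts S \<subseteq> B"
  shows "subgraph S (geometric_graph s B)"
proof -
  have "e \<in> edges (geometric_graph s B)" if "e \<in> edges S" for e
  proof -
    have "e \<in> edges (geometric_graph s P)" "e \<subseteq> B"
      using assms that by (auto simp: subgraph_def simple_graph_def)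
    moreover from this obtain p q where "e = {p, q}" by (metis edges_geometric_graphD)
    ultimately show ?thesis by (simp add: edge_geometric_graph)
  qed
  then show ?thesis using assms by (auto simp: subgraph_def)
qed

lemma connected_isomorphic:
  assumes "isomorphic S H" "connected_graph H" "simple_graph S"
  shows "connected_graph S"
proof -
  obtain f where f: "bij_betw f (verts S) (verts H)" "(\<lambda>e. f ` e) ` edges S = edges H"
    using assms(1) by (auto simp: isomorphic_def)
  let ?g = "inv_into (verts S) f"
  have edge_back: "{?g a, ?g b} \<in> edges S" if "{a, b} \<in> edges H" for a b
  proof -
    have "{a, b} \<in> (\<lambda>e. f ` e) ` edges S" unfolding f(2) by (rule that)
    then obtain e where e: "e \<in> edges S" "{a, b} = f ` e" by blast
    then have "?g ` {a, b} = e"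
      using f(1) assms(3) by (auto simp: simple_graph_def bij_betw_def inv_into_image_cancel)
    then show ?thesis using e(1) by simp
  qed
  have path: "(\<lambda>x y. {x, y} \<in> edges S)\<^sup>*\<^sup>* (?g a) (?g b)"
    if "(\<lambda>x y. {x, y} \<in> edges H)\<^sup>*\<^sup>* a b" for a b
    using that by (induction rule: rtranclp_induct) (auto dest: edge_back intro: rtranclp.rtrancl_into_rtrancl)
  show ?thesis
    unfolding connected_graph_def
  proof safe
    fix u v assume "u \<in> verts S" "v \<in> verts S"
    moreover from this have "(\<lambda>x y. {x, y} \<in> edges H)\<^sup>*\<^sup>* (f u) (f v)"
      using assms(2) f(1) by (auto simp: connected_graph_def bij_betw_def)
    ultimately show "(\<lambda>x y. {x, y} \<in> edges S)\<^sup>*\<^sup>* u v"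
      using path[of "f u" "f v"] f(1) by (simp add: bij_betw_def)
  qed
qed

text \<open>\<open>r\<close> need not reach the order of the pattern once it reaches that of the host graph.\<close>

lemma subgraph_isomorphism_nbh:
  assumes inst: "is_instance Subgraph_Isomorphism s (G, P, H, k)" and "0 < k"
    and r: "k \<le> int r \<or> card P \<le> r"
  shows "yes_instance Subgraph_Isomorphism (G, P, H, k) \<longleftrightarrow>
    (\<exists>p\<in>P. \<exists>S. subgraph S (geometric_graph s (nbh (edges G) {} p r)) \<and> isomorphic S H)"
    (is "?L \<longleftrightarrow> ?R")
proof
  have G: "G = geometric_graph s P" "finite P" "connected_graph H" "k = int (card (verts H))"
    using inst by auto
  show "?L \<Longrightarrow> ?R"
  proof -
    assume ?L
    then obtain S where S: "subgraph S G" "isomorphic S H" by auto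
    have "card (verts S) = card (verts H)"
      using S(2) bij_betw_same_card by (auto simp: isomorphic_def)
    \<comment> \<open>Positivity of \<open>k\<close> supplies a vertex of the copy as the centre of
      the ball.\<close>
    then have "verts S \<noteq> {}" using \<open>0 < k\<close> G(4) by auto
    then obtain p where p: "p \<in> verts S" by auto
    have SG: "simple_graph S" "verts S \<subseteq> P" "edges S \<subseteq> edges G"
      using S(1) G(1) by (auto simp: subgraph_def)
    then have finS: "finite (verts S)" "\<forall>e\<in>edges S. e \<subseteq> verts S" by (auto simp: simple_graph_def)
    have "card (verts S) \<le> r"
      using r card_mono[OF G(2) SG(2)] G(4) \<open>card (verts S) = card (verts H)\<close> by auto
    have "verts S \<subseteq> nbh (edges G) {} p r"
    proof
      fix q assume "q \<in> verts S"
      \<comment> \<open>The search runs inside the copy, which has at most \<open>r\<close> vertices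
        and so is exhausted by \<open>r\<close> rounds; more edges can only enlarge the
        result.\<close>
      then have "(link (edges S) {})\<^sup>*\<^sup>* p q"
        using connected_isomorphic[OF S(2) G(3) SG(1)] p by (simp add: connected_graph_def link_empty)
      then have "q \<in> nbh (edges S) {} p r"
        using links_nbh[OF finS p \<open>card (verts S) \<le> r\<close>] by blast
      then show "q \<in> nbh (edges G) {} p r" using nbh_mono_edges[OF SG(3)] by blast
    qed
    then show ?R using subgraph_restrict_geometric S p SG(2) G(1) by blast
  qed
  show "?R \<Longrightarrow> ?L"
  proof -
    assume ?R
    then obtain p S where p: "p \<in> P" "isomorphic S H"
      "subgraph S (geometric_graph s (nbh (edges G) {} p r))" by auto
    have "nbh (edges G) {} p r \<subseteq> P"
      unfolding G(1) by (rule nbh_subset[OF edges_geometric_graph_subset p(1)])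
    then have "subgraph S G" unfolding G(1) using subgraph_trans_geometric p(3) G(1) by blast
    then show ?L unfolding yes_instance.simps using p(2) by blast
  qed
qed

text \<open>Reachability is expressed by \<open>n\<close> rounds of the search, the form in which
  the program has it; it is exact once \<open>n\<close> is at least the order of the graph.
  \<open>x\<close> ranges over the whole type, but only vertices of the graph can make a
  difference.\<close>

definition far :: "'a set set \<Rightarrow> nat \<Rightarrow> nat \<Rightarrow> 'a \<Rightarrow> 'a \<Rightarrow> bool" where
  "far E n r u w \<longleftrightarrow> w \<notin> nbh E {} u r \<and> w \<in> nbh E {} u n \<and>
     (\<forall>x. x \<noteq> u \<and> x \<noteq> w \<longrightarrow> w \<in> nbh E {x} u n)"

lemma closed_path_length_le:
  assumes "closed_path E vs" "\<forall>e\<in>E. e \<subseteq> V" "finite V"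
  shows "length vs \<le> card V"
proof -
  have "set vs \<subseteq> V"
  proof
    fix v assume "v \<in> set vs"
    then show "v \<in> V" using closed_path_nth[OF assms(1)] assms(2) by (metis in_set_conv_nth insert_subset)
  qed
  then show ?thesis using assms(1,3) by (metis card_mono closed_path_def distinct_card)
qed

text \<open>This direction holds for every \<open>n\<close>, as being found in \<open>n\<close>
  rounds already yields a walk. The closed path is long because a short one would stay in the ball
  around \<open>u\<close>.\<close>

lemma far_closed_path:
  assumes "far E n r u w"
  obtains vs where "closed_path E vs" "u \<in> set vs" "w \<in> set vs" "r + 1 < length vs"
proof -
  have "u \<noteq> w" using assms center_in_nbh[of u E "{}" r] by (auto simp: far_def)
  moreover have "(link E {})\<^sup>*\<^sup>* u w" using assms nbh_links[of u "{}" w E n] by (simp add: far_def)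
  moreover have "(link E {x})\<^sup>*\<^sup>* u w" if "x \<noteq> u" "x \<noteq> w" for x
    using assms that nbh_links[of u "{x}" w E n] by (simp add: far_def)
  ultimately obtain vs where vs: "closed_path E vs" "u \<in> set vs" "w \<in> set vs"
    using closed_path_if_not_separated by metis
  moreover have "r + 1 < length vs"
    using closed_path_subset_nbh[OF vs(1,2), of r] vs(3) assms by (force simp: far_def)
  ultimately show ?thesis by (rule that)
qed

text \<open>The converse does need enough rounds: avoiding a deleted vertex may force a detour
  through almost all of the graph.\<close>

lemma closed_path_far:
  assumes "closed_path E vs" "u \<in> set vs" "w \<in> set vs" "w \<notin> nbh E {} u r"
    and V: "finite V" "\<forall>e\<in>E. e \<subseteq> V" "u \<in> V"
  shows "far E (card V) r u w"
proof -
  have "w \<in> nbh E X u (card V)" if "X \<subseteq> {x}" "u \<notin> X" "w \<notin> X" for X x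
    using links_nbh[OF V order_refl] closed_path_not_separated[OF assms(1-3) that(2,3,1)] by blast
  from this[of "{}"] this[of "{x}" x for x] show ?thesis using assms(4) by (auto simp: far_def)
qed

lemma far_yes:
  assumes inst: "is_instance Longest_Cycle s (G, P, H, k)" and "far (edges G) n r u w"
    and r: "r = min m (card P)" "k \<le> int m" "3 \<le> m"
  shows "yes_instance Longest_Cycle (G, P, H, k)" and "m \<le> card P"
proof -
  have G: "G = geometric_graph s P" "finite P" using inst by auto
  obtain vs where vs: "closed_path (edges G) vs" "r + 1 < length vs"
    using far_closed_path[OF assms(2)] by metis
  have "length vs \<le> card P"
    using closed_path_length_le[OF vs(1), of P] edges_geometric_graph_subset G by blast
  \<comment> \<open>A closed path with more than \<open>r + 1\<close> vertices shows
    \<open>r < card P\<close>, so the minimum that defines \<open>r\<close> is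
    \<open>m\<close>.\<close>
  then have r': "r = m" "m \<le> card P" using vs(2) r(1) by linarith+
  have "set vs \<subseteq> P"
  proof
    fix v assume "v \<in> set vs"
    then show "v \<in> P" using closed_path_nth[OF vs(1)] G(1) edge_geometric_graph by (metis in_set_conv_nth)
  qed
  then have "cycle G vs" using vs r' r(3) G(1) by (simp add: cycle_closed_path)
  then show "yes_instance Longest_Cycle (G, P, H, k)" using vs(2) r'(1) r(2) by auto
  show "m \<le> card P" by fact
qed

text \<open>Each vertex of a cycle outside the ball around another one would form a far pair with
  it. Hence whole cycles survive in the balls, whatever their length and whatever \<open>r\<close>
  is.\<close>

lemma longest_cycle_nbh:
  assumes inst: "is_instance Longest_Cycle s (G, P, H, k)"
    and nofar: "\<And>u w. u \<in> P \<Longrightarrow> w \<in> P \<Longrightarrow> \<not> far (edges G) (card P) r u w"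
  shows "yes_instance Longest_Cycle (G, P, H, k) \<longleftrightarrow>
    (\<exists>p\<in>P. \<exists>vs. cycle (geometric_graph s (nbh (edges G) {} p r)) vs \<and> k \<le> int (length vs))"
    (is "?L \<longleftrightarrow> ?R")
proof
  have G: "G = geometric_graph s P" "finite P" using inst by auto
  have sub: "\<forall>e\<in>edges G. e \<subseteq> P" using edges_geometric_graph_subset G(1) by simp
  show "?L \<Longrightarrow> ?R"
  proof -
    assume ?L
    then obtain vs where vs: "cycle G vs" "k \<le> int (length vs)" by auto
    have cl: "closed_path (edges G) vs" "set vs \<subseteq> P" using vs(1) G(1) by (auto simp: cycle_closed_path)
    have "vs \<noteq> []" using vs(1) by (auto simp: cycle_def)
    then obtain u where u: "u \<in> set vs" by (meson list.set_sel(1))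
    have set: "set vs \<subseteq> nbh (edges G) {} u r"
      using closed_path_far[OF cl(1) u _ _ G(2) sub] nofar u cl(2) by blast
    have "cycle (geometric_graph s (nbh (edges G) {} u r)) vs"
      unfolding cycle_def
    proof (intro conjI allI impI)
      fix i assume i: "i < length vs"
      then have "vs ! i \<in> set vs" "vs ! ((i + 1) mod length vs) \<in> set vs"
        by (auto intro!: nth_mem mod_less_divisor)
      moreover have "{vs ! i, vs ! ((i + 1) mod length vs)} \<in> edges G"
        using vs(1) i by (simp add: cycle_def)
      ultimately show "{vs ! i, vs ! ((i + 1) mod length vs)} \<in>
        edges (geometric_graph s (nbh (edges G) {} u r))"
        using set unfolding G(1) edge_geometric_graph by blast
    qed (use vs(1) set in \<open>auto simp: cycle_def\<close>)
    then show ?R using vs(2) u cl(2) by blast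
  qed
  show "?R \<Longrightarrow> ?L"
  proof -
    assume ?R
    then obtain p vs where p: "p \<in> P" "cycle (geometric_graph s (nbh (edges G) {} p r)) vs"
      "k \<le> int (length vs)" by auto
    moreover have "nbh (edges G) {} p r \<subseteq> P" using nbh_subset[OF sub p(1)] .
    ultimately have "cycle G vs"
      using edges_geometric_graph_mono[of "nbh (edges G) {} p r" P s] G(1)
      unfolding cycle_def by fastforce
    then show ?L using p(3) by auto
  qed
qed

section \<open>Total correctness rules with a syntactic time bound\<close>

section \<open>Programs\<close>

text \<open>Every loop of the program below runs at most \<open>N + 3\<close> times on inputs of size \<open>N\<close>.\<close>

primrec tm :: "nat \<Rightarrow> com \<Rightarrow> nat" where
  "tm N Skip = 1"
| "tm N (SetInt as e) = 1"
| "tm N (SetReal as e) = 1"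
| "tm N (Seq c d) = tm N c + tm N d"
| "tm N (Cond b c d) = tm N c + tm N d + 1"
| "tm N (While b c) = (N + 3) * (tm N c + 1) + 1"

text \<open>Adding the bounds of both branches of a conditional, instead of taking their maximum,
  keeps the bound a polynomial. Each level of nesting of loops adds at most one to the
  degree.\<close>

lemma tm_poly: "\<exists>q. \<forall>N. tm N c = poly q N"
proof (induction c)
  case (Seq c d)
  then obtain q r where "\<forall>N. tm N c = poly q N" "\<forall>N. tm N d = poly r N" by auto
  then show ?case by (intro exI[of _ "q + r"]) simp
next
  case (Cond b c d)
  then obtain q r where "\<forall>N. tm N c = poly q N" "\<forall>N. tm N d = poly r N" by auto
  then show ?case by (intro exI[of _ "q + r + [:1:]"]) simp
next
  case (While b c)
  then obtain q where "\<forall>N. tm N c = poly q N" by auto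
  then show ?case by (intro exI[of _ "[:3, 1:] * (q + [:1:]) + [:1:]"]) (simp add: algebra_simps)
qed (auto intro: exI[of _ "[:1:]"])

text \<open>Termination, time and postcondition in one predicate. Since the time bound depends only
  on the program and \<open>N\<close>, the rules below carry no step counts.\<close>

definition runs :: "nat \<Rightarrow> com \<Rightarrow> memory \<Rightarrow> (memory \<Rightarrow> bool) \<Rightarrow> bool" where
  "runs N c M Q \<longleftrightarrow> (\<exists>t M'. exec c M t M' \<and> t \<le> tm N c \<and> Q M')"

lemma runs_mono: "runs N c M Q \<Longrightarrow> (\<And>M'. Q M' \<Longrightarrow> Q' M') \<Longrightarrow> runs N c M Q'"
  unfolding runs_def by blast

lemma runs_Skip: "Q M \<Longrightarrow> runs N Skip M Q"
  unfolding runs_def using exec.Skip by fastforce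

lemma runs_SetInt:
  "Q ((fst M)(map (ival M) as := ival M e), snd M) \<Longrightarrow> runs N (SetInt as e) M Q"
  unfolding runs_def using exec.SetInt by fastforce

lemma runs_SetReal:
  "Q (fst M, (snd M)(map (ival M) as := lval M e)) \<Longrightarrow> runs N (SetReal as e) M Q"
  unfolding runs_def using exec.SetReal by fastforce

lemma runs_Seq:
  assumes "runs N c M R" "\<And>M'. R M' \<Longrightarrow> runs N d M' Q"
  shows "runs N (Seq c d) M Q"
proof -
  obtain t M' where c: "exec c M t M'" "t \<le> tm N c" "R M'" using assms(1) by (auto simp: runs_def)
  obtain u M'' where d: "exec d M' u M''" "u \<le> tm N d" "Q M''"
    using assms(2)[OF c(3)] by (auto simp: runs_def)
  show ?thesis
    unfolding runs_def using exec.Seq[OF c(1) d(1)] c(2) d(2,3)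
    by (intro exI[of _ "t + u"] exI[of _ M'']) simp
qed

lemma runs_Cond:
  assumes "holds M b \<Longrightarrow> runs N c M Q" "\<not> holds M b \<Longrightarrow> runs N d M Q"
  shows "runs N (Cond b c d) M Q"
proof (cases "holds M b")
  case True
  then obtain t M' where c: "exec c M t M'" "t \<le> tm N c" "Q M'"
    using assms(1) by (auto simp: runs_def)
  show ?thesis
    unfolding runs_def using exec.CondTrue[OF True c(1), of d] c(2,3)
    by (intro exI[of _ "t + 1"] exI[of _ M']) simp
next
  case False
  then obtain t M' where c: "exec d M t M'" "t \<le> tm N d" "Q M'"
    using assms(2) by (auto simp: runs_def)
  show ?thesis
    unfolding runs_def using exec.CondFalse[OF False c(1), of c] c(2,3)
    by (intro exI[of _ "t + 1"] exI[of _ M']) simp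
qed

text \<open>The invariant is indexed by the iteration and \<open>nb\<close> is the exact number of
  iterations, so the induction is on those that remain.\<close>

lemma runs_While:
  assumes step: "\<And>i M. i < nb \<Longrightarrow> I i M \<Longrightarrow> holds M b \<and> runs N c M (I (Suc i))"
    and stop: "\<And>M. I nb M \<Longrightarrow> \<not> holds M b" and "nb \<le> N + 3" "I 0 M"
  shows "runs N (While b c) M (I nb)"
proof -
  have "\<exists>t M'. exec (While b c) M t M' \<and> t \<le> (nb - i) * (tm N c + 1) + 1 \<and> I nb M'"
    if "i \<le> nb" "I i M" for i M
    using that
  proof (induction i arbitrary: M rule: inc_induct)
    case base
    show ?case
      using exec.WhileFalse[OF stop[OF base.prems], of c] base.prems
      by (intro exI[of _ 1] exI[of _ M]) simp
  next
    case (step i)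
    obtain t M' where c: "exec c M t M'" "t \<le> tm N c" "I (Suc i) M'"
      using assms(1)[OF step.hyps(2) step.prems] by (auto simp: runs_def)
    obtain u M'' where w: "exec (While b c) M' u M''" "u \<le> (nb - Suc i) * (tm N c + 1) + 1" "I nb M''"
      using step.IH[OF c(3)] by auto
    have "nb - i = Suc (nb - Suc i)" using step.hyps by simp
    then have "t + u + 1 \<le> (nb - i) * (tm N c + 1) + 1" using c(2) w(2) by simp
    moreover have "exec (While b c) M (t + u + 1) M''"
      using assms(1)[OF step.hyps(2) step.prems] by (intro exec.WhileTrue[OF _ c(1) w(1)]) simp
    ultimately show ?case using w(3) by blast
  qed
  from this[OF _ assms(4)] obtain t M' where
    "exec (While b c) M t M'" "t \<le> nb * (tm N c + 1) + 1" "I nb M'" by auto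
  moreover have "nb * (tm N c + 1) \<le> (N + 3) * (tm N c + 1)" using assms(3) by (rule mult_right_mono) simp
  ultimately show ?thesis unfolding runs_def by (intro exI[of _ t] exI[of _ M']) simp
qed

section \<open>Frames and counting loops\<close>

text \<open>
  Frames: \<open>same D D' M M'\<close> allows changes of the integers in \<open>D\<close> and of the reals in \<open>D'\<close>.
  A loop with counter \<open>d\<close> may use all integer cells whose addresses start with a number
  \<open>\<ge> d\<close> as scratch memory.
\<close>

definition same :: "address set \<Rightarrow> address set \<Rightarrow> memory \<Rightarrow> memory \<Rightarrow> bool" where
  "same D D' M M' \<longleftrightarrow>
     (\<forall>a. a \<notin> D \<longrightarrow> fst M' a = fst M a) \<and> (\<forall>a. a \<notin> D' \<longrightarrow> snd M' a = snd M a)"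

definition scr :: "int \<Rightarrow> address set" where
  "scr d = {a. a \<noteq> [] \<and> d \<le> hd a}"

definition under :: "address \<Rightarrow> address set" where
  "under p = {a. \<exists>b. a = p @ b}"

text \<open>In contrast to \<open>under p\<close>, the cell \<open>p\<close> itself is excluded. For
  instance \<open>[2, j, 2]\<close> holds the number of pattern vertices while the cells strictly
  below it hold their names.\<close>

definition sub :: "address \<Rightarrow> address set" where
  "sub p = {a. \<exists>i b. a = p @ i # b}"

lemma Cons_in_scr [simp]: "x # a \<in> scr d \<longleftrightarrow> d \<le> x"
  by (simp add: scr_def)

lemma scr_antimono: "d \<le> e \<Longrightarrow> scr e \<subseteq> scr d"
  by (auto simp: scr_def)

lemma in_under [simp]: "a \<in> under []" "[] \<notin> under (x # p)"
  "y # a \<in> under (x # p) \<longleftrightarrow> x = y \<and> a \<in> under p"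
  by (auto simp: under_def)

lemma in_sub [simp]: "[] \<notin> sub p" "y # a \<in> sub []"
  "y # a \<in> sub (x # p) \<longleftrightarrow> x = y \<and> a \<in> sub p"
  by (auto simp: sub_def append_eq_Cons_conv)

lemma under_sub: "under (p @ [i]) \<subseteq> sub p"
  by (auto simp: under_def sub_def)

lemma sub_under: "a \<in> sub p \<Longrightarrow> a \<in> under p"
  by (auto simp: under_def sub_def)

lemma sub_scr: "p \<noteq> [] \<Longrightarrow> hd p < d \<Longrightarrow> sub p \<inter> scr d = {}"
  by (auto simp: sub_def scr_def)

lemma same_refl [simp]: "same D D' M M"
  by (simp add: same_def)

lemma same_int: "same D D' M M' \<Longrightarrow> a \<notin> D \<Longrightarrow> fst M' a = fst M a"
  and same_real: "same D D' M M' \<Longrightarrow> a \<notin> D' \<Longrightarrow> snd M' a = snd M a"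
  by (auto simp: same_def)

lemma same_mono: "same C C' M M' \<Longrightarrow> C \<subseteq> D \<Longrightarrow> C' \<subseteq> D' \<Longrightarrow> same D D' M M'"
  unfolding same_def by blast

lemma same_trans: "same D D' M M' \<Longrightarrow> same D D' M' M'' \<Longrightarrow> same D D' M M''"
  by (auto simp: same_def)

lemma same_trans_mono:
  "same C C' M M' \<Longrightarrow> same B B' M' M'' \<Longrightarrow> B \<subseteq> D \<Longrightarrow> B' \<subseteq> D' \<Longrightarrow> C \<subseteq> D \<Longrightarrow> C' \<subseteq> D' \<Longrightarrow>
    same D D' M M''"
  by (meson same_mono same_trans)

lemma same_write_int: "a \<in> D \<Longrightarrow> same D D' M ((fst M)(a := v), snd M)"
  and same_write_real: "a \<in> D' \<Longrightarrow> same D D' M (fst M, (snd M)(a := x))"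
  by (auto simp: same_def)

abbreviation V :: "int \<Rightarrow> iexp" where "V x \<equiv> ICell [IConst x]"

definition For :: "int \<Rightarrow> iexp \<Rightarrow> com \<Rightarrow> com" where
  "For d b c = Seq (SetInt [IConst d] (IConst 0))
     (While (TNot (ILe b (V d))) (Seq c (SetInt [IConst d] (IAdd (V d) (IConst 1)))))"

text \<open>The bound is evaluated anew before every iteration, so it must be constant on the frame
  of the loop. Incrementing the counter is a write to \<open>scr d\<close>, to which the invariant
  must be insensitive; the body gets \<open>scr (d + 1)\<close> and so cannot spoil the
  counter.\<close>

lemma runs_For:
  assumes nb: "nb \<le> N + 3" and bound: "\<And>M. same (R \<union> scr d) R' M0 M \<Longrightarrow> ival M b = int nb"
    and I0: "I 0 M0" and ins: "\<And>i M M'. I i M \<Longrightarrow> same (scr d) {} M M' \<Longrightarrow> I i M'"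
    and d: "[d] \<notin> R"
    and step: "\<And>i M. i < nb \<Longrightarrow> same (R \<union> scr d) R' M0 M \<Longrightarrow> fst M [d] = int i \<Longrightarrow> I i M \<Longrightarrow>
      runs N c M (\<lambda>M'. I (Suc i) M' \<and> same (R \<union> scr (d + 1)) R' M M')"
  shows "runs N (For d b c) M0 (\<lambda>M'. I nb M' \<and> same (R \<union> scr d) R' M0 M')"
  unfolding For_def
proof (rule runs_Seq, rule runs_SetInt)
  let ?J = "\<lambda>i M. I i M \<and> same (R \<union> scr d) R' M0 M \<and> fst M [d] = int i"
  show "?J 0 ((fst M0)(map (ival M0) [IConst d] := ival M0 (IConst 0)), snd M0)"
    using ins[OF I0] by (simp add: same_write_int)
  fix M assume "?J 0 M"
  have "runs N (While (TNot (ILe b (V d))) (Seq c (SetInt [IConst d] (IAdd (V d) (IConst 1))))) M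
    (?J nb)"
  proof (rule runs_While[where I = ?J, OF _ _ nb \<open>?J 0 M\<close>], rule conjI)
    fix i M assume i: "i < nb" and J: "?J i M"
    show "holds M (TNot (ILe b (V d)))" using bound[of M] J i by simp
    show "runs N (Seq c (SetInt [IConst d] (IAdd (V d) (IConst 1)))) M (?J (Suc i))"
    proof (rule runs_Seq[OF step[of i M]])
      fix M' assume M': "I (Suc i) M' \<and> same (R \<union> scr (d + 1)) R' M M'"
      then have "fst M' [d] = int i" using same_int[of _ _ M M' "[d]"] J d by fastforce
      moreover have "same (R \<union> scr d) R' M0 M'"
        using J M' same_trans_mono[of "R \<union> scr d" R' M0 M "R \<union> scr (d + 1)" R' M' "R \<union> scr d" R']
          scr_antimono[of d "d + 1"] by auto
      ultimately show "runs N (SetInt [IConst d] (IAdd (V d) (IConst 1))) M' (?J (Suc i))"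
        using M' by (intro runs_SetInt)
          (auto intro!: ins[of "Suc i" M'] same_write_int intro: same_trans)
    qed (use i J in auto)
  qed (use bound in auto)
  then show "runs N (While (TNot (ILe b (V d))) (Seq c (SetInt [IConst d] (IAdd (V d) (IConst 1))))) M
    (\<lambda>M'. I nb M' \<and> same (R \<union> scr d) R' M0 M')"
    by (rule runs_mono) simp
qed

text \<open>
  A loop whose \<open>i\<close>-th iteration fills an area of its own, namely the cells below the address
  \<open>p @ [i]\<close>: integers if \<open>\<alpha>\<close>, reals if \<open>\<beta>\<close>.
\<close>

lemma runs_For_fill:
  assumes nb: "nb \<le> N + 3" and p: "p \<noteq> []" "hd p < d"
    and bound: "\<And>M. same ((if \<alpha> then sub p else {}) \<union> scr d) (if \<beta> then sub p else {}) M0 M \<Longrightarrow>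
      ival M b = int nb"
    and loc: "\<And>i M M'. i < nb \<Longrightarrow> Q i M \<Longrightarrow>
      (\<alpha> \<Longrightarrow> \<forall>a\<in>under (p @ [int i]). fst M' a = fst M a) \<Longrightarrow>
      (\<beta> \<Longrightarrow> \<forall>a\<in>under (p @ [int i]). snd M' a = snd M a) \<Longrightarrow> Q i M'"
    and step: "\<And>i M. i < nb \<Longrightarrow>
      same ((if \<alpha> then sub p else {}) \<union> scr d) (if \<beta> then sub p else {}) M0 M \<Longrightarrow>
      fst M [d] = int i \<Longrightarrow> \<forall>j<i. Q j M \<Longrightarrow>
      runs N c M (\<lambda>M'. Q i M' \<and> same ((if \<alpha> then under (p @ [int i]) else {}) \<union> scr (d + 1))
        (if \<beta> then under (p @ [int i]) else {}) M M')"
  shows "runs N (For d b c) M0 (\<lambda>M'. (\<forall>i<nb. Q i M') \<and>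
    same ((if \<alpha> then sub p else {}) \<union> scr d) (if \<beta> then sub p else {}) M0 M')"
proof -
  let ?I = "\<lambda>i M. \<forall>j<i. j < nb \<longrightarrow> Q j M"
  have disj: "a \<notin> under (p @ [int j])" if "a \<in> under (p @ [int i])" "i \<noteq> j" for a i j
    using that by (auto simp: under_def)
  have noscr: "a \<notin> scr d" if "a \<in> under (p @ [int i])" for a i
    using that sub_scr[OF p] under_sub by fastforce
  have "runs N (For d b c) M0 (\<lambda>M'. ?I nb M' \<and>
    same ((if \<alpha> then sub p else {}) \<union> scr d) (if \<beta> then sub p else {}) M0 M')"
  proof (rule runs_For[where I = ?I, OF nb bound])
    show "?I 0 M0" by simp
    show "[d] \<notin> (if \<alpha> then sub p else {})" using p by (cases p) auto
    fix i M
    show "?I i M'" if "?I i M" "same (scr d) {} M M'" for M'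
    proof (intro allI impI)
      fix j assume j: "j < i" "j < nb"
      show "Q j M'"
        using loc[OF j(2), of M M'] that j noscr same_int[OF that(2)] same_real[OF that(2)] by auto
    qed
    assume i: "i < nb" "fst M [d] = int i" "?I i M"
      and s: "same ((if \<alpha> then sub p else {}) \<union> scr d) (if \<beta> then sub p else {}) M0 M"
    show "runs N c M (\<lambda>M'. ?I (Suc i) M' \<and>
      same ((if \<alpha> then sub p else {}) \<union> scr (d + 1)) (if \<beta> then sub p else {}) M M')"
    proof (rule runs_mono[OF step[OF i(1) s i(2)]])
      show "\<forall>j<i. Q j M" using i by auto
      fix M' assume M': "Q i M' \<and> same ((if \<alpha> then under (p @ [int i]) else {}) \<union> scr (d + 1))
        (if \<beta> then under (p @ [int i]) else {}) M M'"
      \<comment> \<open>The area of iteration \<open>j\<close> is disjoint from that of iteration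
        \<open>i\<close> and from the scratch cells, so its contents survive.\<close>
      have "Q j M'" if "j < i" for j
      proof (rule loc)
        show "j < nb" "Q j M" using that i by auto
        have "scr (d + 1) \<subseteq> scr d" by (rule scr_antimono) simp
        then have "a \<notin> under (p @ [int i]) \<and> a \<notin> scr (d + 1)" if "a \<in> under (p @ [int j])" for a
          using disj[OF that, of i] noscr[OF that] \<open>j < i\<close> by blast
        then show "\<forall>a\<in>under (p @ [int j]). fst M' a = fst M a"
          using M' by (simp add: same_def)
        show "\<forall>a\<in>under (p @ [int j]). snd M' a = snd M a"
          using M' disj[of _ j i] that by (auto simp: same_def)
      qed
      moreover have "same ((if \<alpha> then sub p else {}) \<union> scr (d + 1)) (if \<beta> then sub p else {}) M M'"
        by (rule same_mono[OF conjunct2[OF M']]) (use under_sub[of p "int i"] in auto)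
      ultimately show "?I (Suc i) M' \<and>
        same ((if \<alpha> then sub p else {}) \<union> scr (d + 1)) (if \<beta> then sub p else {}) M M'"
        using M' by (auto simp: less_Suc_eq)
    qed
  qed
  then show ?thesis by (rule runs_mono) auto
qed

lemmas runs_For_ints = runs_For_fill[where \<alpha> = True and \<beta> = False, simplified]
lemmas runs_For_reals = runs_For_fill[where \<alpha> = False and \<beta> = True, simplified]
lemmas runs_For_cells = runs_For_fill[where \<alpha> = True and \<beta> = True, simplified]

text \<open>For existential searches. If nothing is found the flag keeps its former value, so
  successive searches can share one flag and form a disjunction.\<close>

lemma runs_For_flag:
  assumes nb: "nb \<le> N + 3" and f: "f < d"
    and bound: "\<And>M. same (insert [f] (scr d)) {} M0 M \<Longrightarrow> ival M b = int nb"
    and step: "\<And>i M. i < nb \<Longrightarrow> same (insert [f] (scr d)) {} M0 M \<Longrightarrow> fst M [d] = int i \<Longrightarrow>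
      runs N c M (\<lambda>M'. fst M' [f] = (if B i then v else fst M [f]) \<and>
        same (insert [f] (scr (d + 1))) {} M M')"
  shows "runs N (For d b c) M0 (\<lambda>M'. fst M' [f] = (if \<exists>i<nb. B i then v else fst M0 [f]) \<and>
    same (insert [f] (scr d)) {} M0 M')"
proof -
  let ?I = "\<lambda>i M. fst M [f] = (if \<exists>j<i. B j then v else fst M0 [f])"
  have "runs N (For d b c) M0 (\<lambda>M'. ?I nb M' \<and> same ({[f]} \<union> scr d) {} M0 M')"
  proof (rule runs_For[where I = ?I, OF nb])
    fix i M assume "i < nb" "same ({[f]} \<union> scr d) {} M0 M" "fst M [d] = int i" "?I i M"
    then show "runs N c M (\<lambda>M'. ?I (Suc i) M' \<and> same ({[f]} \<union> scr (d + 1)) {} M M')"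
      by (intro runs_mono[OF step[of i M]]) (auto simp: less_Suc_eq)
  next
    fix i M M' assume "?I i M" "same (scr d) {} M M'"
    then show "?I i M'" using same_int[of _ _ M M' "[f]"] f by (simp cong: if_cong)
  qed (use f bound in auto)
  then show ?thesis by simp
qed

section \<open>The kernelization as a program\<close>

section \<open>The program\<close>

text \<open>Memory map by first address component: 0 input, -2 table of searches, -4 and -3 the
  values \<open>m\<close> and \<open>r\<close>, 1 and 2 output, 3 the flag for a known yes, from 10
  on counters and scratch. Everything below 10 is thus outside the scratch of all loops.\<close>

abbreviation cN :: iexp where "cN \<equiv> ICell [IConst 0, IConst 0]"
abbreviation cH :: iexp where "cH \<equiv> ICell [IConst 0, IConst 2]"
abbreviation cK :: iexp where "cK \<equiv> ICell [IConst 0, IConst 4]"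
abbreviation cM :: iexp where "cM \<equiv> V (- 4)"
abbreviation cR :: iexp where "cR \<equiv> V (- 3)"
abbreviation cA :: "iexp \<Rightarrow> iexp \<Rightarrow> iexp" where "cA i j \<equiv> ICell [IConst 0, IConst 1, i, j]"
abbreviation aT :: "iexp \<Rightarrow> iexp \<Rightarrow> iexp \<Rightarrow> iexp \<Rightarrow> iexp list" where
  "aT t u x i \<equiv> [IConst (- 2), t, u, x, i]"
abbreviation ieq :: "iexp \<Rightarrow> iexp \<Rightarrow> test" where "ieq a b \<equiv> TAnd (ILe a b) (ILe b a)"
abbreviation isucc :: "iexp \<Rightarrow> iexp" where "isucc a \<equiv> IAdd a (IConst 1)"
abbreviation ipred :: "iexp \<Rightarrow> iexp" where "ipred a \<equiv> ISub a (IConst 1)"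

definition params_com :: com where
  "params_com = Seq
     (Cond (ILe cK (IConst 3)) (SetInt [IConst (- 4)] (IConst 3)) (SetInt [IConst (- 4)] cK))
     (Cond (ILe cM cN) (SetInt [IConst (- 3)] cM) (SetInt [IConst (- 3)] cN))"

text \<open>
  The cell \<open>[- 2, t, u, x, i]\<close> says whether point \<open>i\<close> can be reached from point \<open>u\<close> in \<open>t\<close> steps
  that do not enter point \<open>x\<close>; no point has the number \<open>x = n\<close>.
\<close>

definition cell_com :: com where
  "cell_com = Cond (ILe (V 10) (IConst 0))
     (Cond (ieq (V 13) (V 11))
       (SetInt (aT (V 10) (V 11) (V 12) (V 13)) (IConst 1))
       (SetInt (aT (V 10) (V 11) (V 12) (V 13)) (IConst 0)))
     (Seq (SetInt [IConst 14] (ICell (aT (ipred (V 10)) (V 11) (V 12) (V 13))))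
     (Seq (For 15 cN
       (Cond (TAnd (ILe (IConst 1) (ICell (aT (ipred (V 10)) (V 11) (V 12) (V 15))))
               (TAnd (ILe (IConst 1) (cA (V 15) (V 13))) (TNot (ieq (V 13) (V 12)))))
         (SetInt [IConst 14] (IConst 1)) Skip))
     (SetInt (aT (V 10) (V 11) (V 12) (V 13)) (V 14))))"

text \<open>The number of steps is the outermost counter, so that each layer reads a completed one.
  The layers 0 to \<open>n\<close> suffice: later only the layers \<open>r\<close> and
  \<open>n\<close> are read, for balls and for reachability.\<close>

definition table_com :: com where
  "table_com = For 10 (isucc cN) (For 11 cN (For 12 (isucc cN) (For 13 cN cell_com)))"

text \<open>Absolute values become pairs of linear comparisons. These are the only tests on reals;
  adjacency is read from the stored matrix, so the program does not depend on the shape.\<close>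

abbreviation near_test :: test where
  "near_test \<equiv>
    (let le = (\<lambda>c a b. RLe (RLin (LCell [IConst 0, IConst c, a]))
       (RLin (LAdd (LCell [IConst 0, IConst c, b]) (LConst (1/2)))))
     in TAnd (TAnd (le 0 (V 10) (V 12)) (le 0 (V 12) (V 10)))
             (TAnd (le 1 (V 10) (V 12)) (le 1 (V 12) (V 10))))"

definition dense_com :: com where
  "dense_com = For 10 cN
     (Seq (SetInt [IConst 11] (IConst 0))
     (Seq (For 12 cN (Cond near_test (SetInt [IConst 11] (isucc (V 11))) Skip))
     (Cond (ILe cM (V 11)) (SetInt [IConst 3] (IConst 1)) Skip)))"

text \<open>The cell \<open>[12]\<close> is cleared as soon as some \<open>x\<close> separates the
  pair. The value \<open>x = n\<close> always takes part, so plain reachability is among the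
  conditions tested.\<close>

definition far_com :: com where
  "far_com = For 10 cN (For 11 cN
     (Cond (ILe (ICell (aT cR (V 10) cN (V 11))) (IConst 0))
       (Seq (SetInt [IConst 12] (IConst 1))
       (Seq (For 13 (isucc cN)
         (Cond (TAnd (TNot (ieq (V 13) (V 10))) (TAnd (TNot (ieq (V 13) (V 11)))
                 (ILe (ICell (aT cN (V 10) (V 13) (V 11))) (IConst 0))))
           (SetInt [IConst 12] (IConst 0)) Skip))
       (Cond (ILe (IConst 1) (V 12)) (SetInt [IConst 3] (IConst 1)) Skip)))
       Skip))"

text \<open>A pattern without vertices occurs in every graph, even in one without points, for which
  there would be no ball to output.\<close>

fun special_com :: "problem \<Rightarrow> com" where
  "special_com Subgraph_Isomorphism = Cond (ILe cK (IConst 0)) (SetInt [IConst 3] (IConst 1)) Skip"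
| "special_com Longest_Cycle = far_com"

definition pattern_com :: "iexp \<Rightarrow> com" where
  "pattern_com J =
     Seq (SetInt [IConst 2, J, IConst 2] cH)
     (Seq (SetInt [IConst 2, J, IConst 4] cK)
     (Seq (For 12 cH (SetInt [IConst 2, J, IConst 2, V 12] (ICell [IConst 0, IConst 2, V 12])))
     (For 12 cH (For 13 cH
       (SetInt [IConst 2, J, IConst 3, V 12, V 13] (ICell [IConst 0, IConst 3, V 12, V 13]))))))"

definition clique_com :: com where
  "clique_com =
     Seq (SetInt [IConst 1] (IConst 1))
     (Seq (SetInt [IConst 2, IConst 0, IConst 0] cM)
     (Seq (For 12 cM (For 13 cM (Cond (ieq (V 12) (V 13))
       (SetInt [IConst 2, IConst 0, IConst 1, V 12, V 13] (IConst 0))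
       (SetInt [IConst 2, IConst 0, IConst 1, V 12, V 13] (IConst 1)))))
     (Seq (For 12 cM (Cond (ILe (V 12) (IConst 0))
       (SetReal [IConst 2, IConst 0, IConst 0, V 12] (LConst 1))
       (SetReal [IConst 2, IConst 0, IConst 0, V 12]
         (LScale (1/2) (LCell [IConst 2, IConst 0, IConst 0, ipred (V 12)])))))
     (Seq (For 12 cM (SetReal [IConst 2, IConst 0, IConst 1, V 12] (LConst 0)))
     (pattern_com (IConst 0))))))"

text \<open>The cells \<open>[11, a]\<close> with \<open>a\<close> below the value of \<open>[11]\<close> list the members of a ball.\<close>

definition ball_com :: com where
  "ball_com =
     Seq (SetInt [IConst 11] (IConst 0))
     (Seq (For 12 cN (Cond (ILe (IConst 1) (ICell (aT cR (V 10) cN (V 12))))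
       (Seq (SetInt [IConst 11, V 11] (V 12)) (SetInt [IConst 11] (isucc (V 11)))) Skip))
     (Seq (SetInt [IConst 2, V 10, IConst 0] (V 11))
     (Seq (For 12 (V 11) (For 13 (V 11)
       (SetInt [IConst 2, V 10, IConst 1, V 12, V 13]
         (cA (ICell [IConst 11, V 12]) (ICell [IConst 11, V 13])))))
     (Seq (For 12 (V 11) (SetReal [IConst 2, V 10, IConst 0, V 12]
       (LCell [IConst 0, IConst 0, ICell [IConst 11, V 12]])))
     (Seq (For 12 (V 11) (SetReal [IConst 2, V 10, IConst 1, V 12]
       (LCell [IConst 0, IConst 1, ICell [IConst 11, V 12]])))
     (pattern_com (V 10)))))))"

definition kernel_com :: "problem \<Rightarrow> com" where
  "kernel_com prob =
     Seq params_com (Seq table_com (Seq (SetInt [IConst 3] (IConst 0)) (Seq dense_com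
     (Seq (special_com prob) (Cond (ILe (IConst 1) (V 3)) clique_com
       (Seq (SetInt [IConst 1] cN) (For 10 cN ball_com)))))))"

section \<open>Relating memory to the stored instance\<close>

section \<open>Correctness of the program\<close>

lemma stores_instance_iff:
  "stores_instance M a (G, P, H, k) \<longleftrightarrow>
     (\<exists>ps hs. distinct ps \<and> set ps = P \<and> distinct hs \<and> set hs = verts H \<and>
        fst M (a @ [0]) = int (length ps) \<and>
        (\<forall>i<length ps. snd M (a @ [0, int i]) = fst (ps ! i) \<and> snd M (a @ [1, int i]) = snd (ps ! i)) \<and>
        (\<forall>i<length ps. \<forall>j<length ps.
           fst M (a @ [1, int i, int j]) = (if {ps ! i, ps ! j} \<in> edges G then 1 else 0)) \<and>
        fst M (a @ [2]) = int (length hs) \<and>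
        (\<forall>i<length hs. fst M (a @ [2, int i]) = int (hs ! i)) \<and>
        (\<forall>i<length hs. \<forall>j<length hs.
           fst M (a @ [3, int i, int j]) = (if {hs ! i, hs ! j} \<in> edges H then 1 else 0)) \<and>
        fst M (a @ [4]) = k)"
  by (cases M) simp

lemma stores_instance_cong:
  assumes "stores_instance M a X"
    "\<forall>b\<in>under a. fst M' b = fst M b" "\<forall>b\<in>under a. snd M' b = snd M b"
  shows "stores_instance M' a X"
proof -
  obtain G P H k where X: "X = (G, P, H, k)" by (cases X)
  have "fst M' (a @ b) = fst M (a @ b)" "snd M' (a @ b) = snd M (a @ b)" for b
    using assms(2,3) by (auto simp: under_def)
  then show ?thesis using assms(1) unfolding X stores_instance_iff by simp
qed

text \<open>The enumerations are those in which the input happens to be stored. The program handles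
  points only as indices into them.\<close>

locale stored_instance =
  fixes prob :: problem and s :: shape and G :: "point ugraph" and P :: "point set"
    and H :: "nat ugraph" and k :: int and ps :: "point list" and hs :: "nat list"
  assumes inst: "is_instance prob s (G, P, H, k)"
    and ps: "distinct ps" "set ps = P" and hs: "distinct hs" "set hs = verts H"
begin

abbreviation "n \<equiv> length ps"
abbreviation "h \<equiv> length hs"
abbreviation "N \<equiv> n + h"
definition "m = max 3 (nat k)"
text \<open>The table has no layer beyond \<open>n\<close>, and \<open>m\<close> may be far larger;
  nothing is lost, since \<open>n\<close> rounds already exhaust a component.\<close>

definition "r = min m n"

text \<open>The deleted vertex is given by its index; an index from \<open>n\<close> on deletes
  nothing.\<close>

definition ball :: "nat \<Rightarrow> nat \<Rightarrow> nat \<Rightarrow> point set" where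
  "ball t u x = nbh (edges G) (if x < n then {ps ! x} else {}) (ps ! u) t"

lemma G: "G = geometric_graph s P" "finite P"
  using inst by (cases prob; simp)+

lemma n: "n = card P"
  using ps distinct_card[of ps] by simp

lemma edges_P: "\<forall>e\<in>edges G. e \<subseteq> P"
  using G edges_geometric_graph_subset by simp

lemma nth_P: "i < n \<Longrightarrow> ps ! i \<in> P"
  using ps(2) nth_mem by blast

lemma ball_subset: "u < n \<Longrightarrow> ball t u x \<subseteq> P"
  unfolding ball_def by (rule nbh_subset[OF edges_P]) (rule nth_P)

lemma ball_0: "u < n \<Longrightarrow> i < n \<Longrightarrow> ps ! i \<in> ball 0 u x \<longleftrightarrow> i = u"
  using ps(1) by (simp add: ball_def nth_eq_iff_index_eq)

lemma ball_Suc: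
  assumes "u < n" "i < n"
  shows "ps ! i \<in> ball (Suc t) u x \<longleftrightarrow> ps ! i \<in> ball t u x \<or>
    (\<exists>j<n. ps ! j \<in> ball t u x \<and> {ps ! j, ps ! i} \<in> edges G \<and> i \<noteq> x)"
proof -
  have "ps ! i \<notin> (if x < n then {ps ! x} else {}) \<longleftrightarrow> i \<noteq> x"
    using assms ps(1) by (auto simp: nth_eq_iff_index_eq)
  moreover have "(\<exists>b\<in>ball t u x. {b, ps ! i} \<in> edges G) \<longleftrightarrow>
      (\<exists>j<n. ps ! j \<in> ball t u x \<and> {ps ! j, ps ! i} \<in> edges G)"
    (is "?l \<longleftrightarrow> ?r")
  proof
    assume ?l
    then obtain b where b: "b \<in> ball t u x" "{b, ps ! i} \<in> edges G" by blast
    then have "b \<in> set ps" using ball_subset[OF assms(1), of t x] ps(2) by blast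
    then obtain j where "j < n" "b = ps ! j" by (metis in_set_conv_nth)
    then show ?r using b by blast
  qed blast
  moreover have "ps ! i \<in> ball (Suc t) u x \<longleftrightarrow> ps ! i \<in> ball t u x \<or>
      ps ! i \<notin> (if x < n then {ps ! x} else {}) \<and> (\<exists>b\<in>ball t u x. {b, ps ! i} \<in> edges G)"
    unfolding ball_def nbh.simps by blast
  ultimately show ?thesis by blast
qed

definition inp :: "memory \<Rightarrow> bool" where
  "inp M \<longleftrightarrow> fst M [0, 0] = int n \<and>
     (\<forall>i<n. snd M [0, 0, int i] = fst (ps ! i) \<and> snd M [0, 1, int i] = snd (ps ! i)) \<and>
     (\<forall>i<n. \<forall>j<n. fst M [0, 1, int i, int j] = of_bool ({ps ! i, ps ! j} \<in> edges G)) \<and>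
     fst M [0, 2] = int h \<and> (\<forall>i<h. fst M [0, 2, int i] = int (hs ! i)) \<and>
     (\<forall>i<h. \<forall>j<h. fst M [0, 3, int i, int j] = of_bool ({hs ! i, hs ! j} \<in> edges H)) \<and>
     fst M [0, 4] = k"

definition par :: "memory \<Rightarrow> bool" where
  "par M \<longleftrightarrow> inp M \<and> fst M [- 4] = int m \<and> fst M [- 3] = int r"

definition tab :: "memory \<Rightarrow> bool" where
  "tab M \<longleftrightarrow> par M \<and> (\<forall>t\<le>n. \<forall>u<n. \<forall>x\<le>n. \<forall>i<n.
     fst M [- 2, int t, int u, int x, int i] = of_bool (ps ! i \<in> ball t u x))"

lemma inp_same:
  assumes "same D D' M M'" "inp M" "\<And>a. 0 # a \<notin> D" "\<And>a. 0 # a \<notin> D'"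
  shows "inp M'"
proof -
  have "fst M' (0 # a) = fst M (0 # a)" "snd M' (0 # a) = snd M (0 # a)" for a
    using assms by (auto simp: same_def)
  then show ?thesis using assms(2) unfolding inp_def by simp
qed

lemma par_same:
  assumes "same D D' M M'" "par M" "\<And>a. 0 # a \<notin> D" "\<And>a. 0 # a \<notin> D'" "[- 4] \<notin> D" "[- 3] \<notin> D"
  shows "par M'"
  using assms inp_same[OF assms(1)] by (auto simp: par_def same_def)

lemma tab_same:
  assumes "same D D' M M'" "tab M" "\<And>a. 0 # a \<notin> D" "\<And>a. 0 # a \<notin> D'" "[- 4] \<notin> D" "[- 3] \<notin> D"
    "\<And>a. - 2 # a \<notin> D"
  shows "tab M'"
  using assms par_same[OF assms(1)] by (simp add: tab_def same_def)

section \<open>Computing the parameters and the table of searches\<close>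

lemma params_runs: "inp M \<Longrightarrow> runs N params_com M par"
  unfolding params_com_def
  by (rule runs_Seq[where R = "\<lambda>M. inp M \<and> fst M [- 4] = int m"]; rule runs_Cond; rule runs_SetInt)
    (auto simp: inp_def par_def m_def r_def)

text \<open>Beyond layer 0, the cell \<open>[14]\<close> starts with the entry of the previous layer
  and is raised to 1 when a neighbour was reached there; this is the recursion
  \<open>ball_Suc\<close>.\<close>

lemma cell_runs:
  assumes "par M" "fst M [10] = int t" "fst M [11] = int u" "fst M [12] = int x" "fst M [13] = int i"
    and lt: "u < n" "x \<le> n" "i < n"
    and prev: "0 < t \<Longrightarrow> \<forall>j<n. fst M [- 2, int t - 1, int u, int x, int j] = of_bool (ps ! j \<in> ball (t - 1) u x)"
  shows "runs N cell_com M (\<lambda>M'. fst M' [- 2, int t, int u, int x, int i] = of_bool (ps ! i \<in> ball t u x) \<and>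
    same (under [- 2, int t, int u, int x, int i] \<union> scr 14) {} M M')"
proof (cases "t = 0")
  case True
  then show ?thesis
    unfolding cell_com_def using assms lt
    by (intro runs_Cond runs_SetInt) (auto simp: ball_0 intro!: same_write_int)
next
  case False
  let ?B = "\<lambda>j. ps ! j \<in> ball (t - 1) u x \<and> {ps ! j, ps ! i} \<in> edges G \<and> i \<noteq> x"
  let ?b = "of_bool (ps ! i \<in> ball (t - 1) u x) :: int"
  let ?R1 = "\<lambda>M'. fst M' [14] = ?b \<and> same (scr 14) {} M M'"
  let ?R2 = "\<lambda>M'. fst M' [14] = of_bool (ps ! i \<in> ball t u x) \<and> same (scr 14) {} M M'"
  have c1: "runs N (SetInt [IConst 14] (ICell (aT (ipred (V 10)) (V 11) (V 12) (V 13)))) M ?R1"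
    using assms False by (intro runs_SetInt) (auto intro!: same_write_int)
  have c2: "runs N (For 15 cN
       (Cond (TAnd (ILe (IConst 1) (ICell (aT (ipred (V 10)) (V 11) (V 12) (V 15))))
               (TAnd (ILe (IConst 1) (cA (V 15) (V 13))) (TNot (ieq (V 13) (V 12)))))
         (SetInt [IConst 14] (IConst 1)) Skip)) M1 ?R2" if M1: "?R1 M1" for M1
  proof (rule runs_mono[OF runs_For_flag[where B = ?B and v = 1]])
    show "n \<le> N + 3" "(14::int) < 15" by simp_all
    fix M2 assume s2: "same (insert [14] (scr 15)) {} M1 M2"
    have s: "same (scr 14) {} M M2"
      by (rule same_trans_mono[OF conjunct2[OF M1] s2]) (auto intro: scr_antimono[THEN subsetD, rotated])
    note rd = same_int[OF s]
    have "par M2" by (rule par_same[OF s \<open>par M\<close>]) auto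
    then show "ival M2 cN = int n" by (simp add: par_def inp_def)
    fix j assume j: "j < n" "fst M2 [15] = int j"
    show "runs N (Cond (TAnd (ILe (IConst 1) (ICell (aT (ipred (V 10)) (V 11) (V 12) (V 15))))
               (TAnd (ILe (IConst 1) (cA (V 15) (V 13))) (TNot (ieq (V 13) (V 12)))))
         (SetInt [IConst 14] (IConst 1)) Skip) M2
       (\<lambda>M'. fst M' [14] = (if ?B j then 1 else fst M2 [14]) \<and> same (insert [14] (scr (15 + 1))) {} M2 M')"
      using \<open>par M2\<close> j assms False rd
      by (intro runs_Cond runs_SetInt runs_Skip) (auto simp: par_def inp_def intro!: same_write_int)
  next
    fix M2
    assume *: "fst M2 [14] = (if \<exists>j<n. ?B j then 1 else fst M1 [14]) \<and> same (insert [14] (scr 15)) {} M1 M2"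
    have "same (scr 14) {} M M2"
      by (rule same_trans_mono[OF conjunct2[OF M1] conjunct2[OF *]])
        (auto intro: scr_antimono[THEN subsetD, rotated])
    moreover have "ps ! i \<in> ball t u x \<longleftrightarrow> ps ! i \<in> ball (t - 1) u x \<or> (\<exists>j<n. ?B j)"
      using ball_Suc[OF lt(1,3), of "t - 1" x] False by simp
    ultimately show "?R2 M2" using * M1 by auto
  qed
  have c3: "runs N (SetInt (aT (V 10) (V 11) (V 12) (V 13)) (V 14)) M1
      (\<lambda>M'. fst M' [- 2, int t, int u, int x, int i] = of_bool (ps ! i \<in> ball t u x) \<and>
        same (under [- 2, int t, int u, int x, int i] \<union> scr 14) {} M M')" if "?R2 M1" for M1
  proof (rule runs_SetInt)
    have M1: "fst M1 [14] = of_bool (ps ! i \<in> ball t u x)" "same (scr 14) {} M M1" using that by auto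
    note rd = same_int[OF M1(2)]
    show "fst ((fst M1)(map (ival M1) (aT (V 10) (V 11) (V 12) (V 13)) := ival M1 (V 14)), snd M1)
        [- 2, int t, int u, int x, int i] = of_bool (ps ! i \<in> ball t u x) \<and>
      same (under [- 2, int t, int u, int x, int i] \<union> scr 14) {} M
        ((fst M1)(map (ival M1) (aT (V 10) (V 11) (V 12) (V 13)) := ival M1 (V 14)), snd M1)"
      using M1(1) rd assms
      by (auto intro!: same_trans[OF same_mono[OF M1(2)] same_write_int])
  qed
  have "runs N (Seq (SetInt [IConst 14] (ICell (aT (ipred (V 10)) (V 11) (V 12) (V 13))))
     (Seq (For 15 cN
       (Cond (TAnd (ILe (IConst 1) (ICell (aT (ipred (V 10)) (V 11) (V 12) (V 15))))
               (TAnd (ILe (IConst 1) (cA (V 15) (V 13))) (TNot (ieq (V 13) (V 12)))))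
         (SetInt [IConst 14] (IConst 1)) Skip))
     (SetInt (aT (V 10) (V 11) (V 12) (V 13)) (V 14)))) M
      (\<lambda>M'. fst M' [- 2, int t, int u, int x, int i] = of_bool (ps ! i \<in> ball t u x) \<and>
        same (under [- 2, int t, int u, int x, int i] \<union> scr 14) {} M M')"
    by (rule runs_Seq[OF c1], rule runs_Seq[OF c2 c3])
  then show ?thesis
    unfolding cell_com_def using False assms(2) by (intro runs_Cond) simp_all
qed

abbreviation tcell :: "nat \<Rightarrow> nat \<Rightarrow> nat \<Rightarrow> nat \<Rightarrow> memory \<Rightarrow> bool" where
  "tcell t u x i M \<equiv> fst M [- 2, int t, int u, int x, int i] = of_bool (ps ! i \<in> ball t u x)"

text \<open>The nested loops are verified from the inside outwards, one lemma for each.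
  \<open>prev\<close> asks for the previous layer only at the \<open>u\<close> and \<open>x\<close>
  of this row.\<close>

lemma table_row_runs:
  assumes "par M0" "fst M0 [10] = int t" "fst M0 [11] = int u" "fst M0 [12] = int x"
    and lt: "u < n" "x \<le> n" and prev: "0 < t \<Longrightarrow> \<forall>j<n. tcell (t - 1) u x j M0"
  shows "runs N (For 13 cN cell_com) M0 (\<lambda>M'. (\<forall>i<n. tcell t u x i M') \<and>
    same (sub [- 2, int t, int u, int x] \<union> scr 13) {} M0 M')"
proof (rule runs_For_ints)
  fix M assume s: "same (sub [- 2, int t, int u, int x] \<union> scr 13) {} M0 M"
  note rd = same_int[OF s]
  have "par M" by (rule par_same[OF s \<open>par M0\<close>]) auto
  then show "ival M cN = int n" by (simp add: par_def inp_def)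
  fix i assume "i < n" "fst M [13] = int i"
  then show "runs N cell_com M (\<lambda>M'. tcell t u x i M' \<and>
      same (under ([- 2, int t, int u, int x] @ [int i]) \<union> scr (13 + 1)) {} M M')"
    using cell_runs[of M t u x i] \<open>par M\<close> assms rd by (simp add: of_nat_diff)
qed auto

lemma table_slice_runs:
  assumes "par M0" "fst M0 [10] = int t" "fst M0 [11] = int u"
    and lt: "u < n" and prev: "0 < t \<Longrightarrow> \<forall>x\<le>n. \<forall>j<n. tcell (t - 1) u x j M0"
  shows "runs N (For 12 (isucc cN) (For 13 cN cell_com)) M0
    (\<lambda>M'. (\<forall>x<n + 1. \<forall>i<n. tcell t u x i M') \<and> same (sub [- 2, int t, int u] \<union> scr 12) {} M0 M')"
proof (rule runs_For_ints)
  fix M assume s: "same (sub [- 2, int t, int u] \<union> scr 12) {} M0 M"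
  note rd = same_int[OF s]
  have "par M" by (rule par_same[OF s \<open>par M0\<close>]) auto
  then show "ival M (isucc cN) = int (n + 1)" by (simp add: par_def inp_def)
  fix x assume "x < n + 1" "fst M [12] = int x"
  then show "runs N (For 13 cN cell_com) M (\<lambda>M'. (\<forall>i<n. tcell t u x i M') \<and>
      same (under ([- 2, int t, int u] @ [int x]) \<union> scr (12 + 1)) {} M M')"
    using \<open>par M\<close> assms rd
    by (intro runs_mono[OF table_row_runs[of M t u x]]) (auto simp: of_nat_diff dest: sub_under elim!: same_mono)
qed auto

lemma table_layer_runs:
  assumes "par M0" "fst M0 [10] = int t"
    and prev: "0 < t \<Longrightarrow> \<forall>u<n. \<forall>x\<le>n. \<forall>j<n. tcell (t - 1) u x j M0"
  shows "runs N (For 11 cN (For 12 (isucc cN) (For 13 cN cell_com))) M0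
    (\<lambda>M'. (\<forall>u<n. \<forall>x\<le>n. \<forall>i<n. tcell t u x i M') \<and> same (sub [- 2, int t] \<union> scr 11) {} M0 M')"
proof (rule runs_For_ints)
  fix M assume s: "same (sub [- 2, int t] \<union> scr 11) {} M0 M"
  note rd = same_int[OF s]
  have "par M" by (rule par_same[OF s \<open>par M0\<close>]) auto
  then show "ival M cN = int n" by (simp add: par_def inp_def)
  fix u assume "u < n" "fst M [11] = int u"
  then show "runs N (For 12 (isucc cN) (For 13 cN cell_com)) M (\<lambda>M'. (\<forall>x\<le>n. \<forall>i<n. tcell t u x i M') \<and>
      same (under ([- 2, int t] @ [int u]) \<union> scr (11 + 1)) {} M M')"
    using \<open>par M\<close> assms rd
    by (intro runs_mono[OF table_slice_runs[of M t u]]) (auto simp: of_nat_diff dest: sub_under elim!: same_mono)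
qed auto

lemma table_runs:
  assumes "par M0"
  shows "runs N table_com M0 tab"
  unfolding table_com_def
proof (rule runs_mono[OF runs_For_ints[where p = "[- 2]" and nb = "n + 1"
    and Q = "\<lambda>t M. \<forall>u<n. \<forall>x\<le>n. \<forall>i<n. tcell t u x i M"]])
  fix M assume s: "same (sub [- 2] \<union> scr 10) {} M0 M"
  have "par M" by (rule par_same[OF s assms]) auto
  then show "ival M (isucc cN) = int (n + 1)" by (simp add: par_def inp_def)
  fix t assume t: "t < n + 1" "fst M [10] = int t"
    and IH: "\<forall>j<t. \<forall>u<n. \<forall>x\<le>n. \<forall>i<n. tcell j u x i M"
  have prev: "\<forall>u<n. \<forall>x\<le>n. \<forall>i<n. tcell (t - 1) u x i M" if "0 < t"
    using spec[OF IH, of "t - 1"] that by simp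
  show "runs N (For 11 cN (For 12 (isucc cN) (For 13 cN cell_com))) M
      (\<lambda>M'. (\<forall>u<n. \<forall>x\<le>n. \<forall>i<n. tcell t u x i M') \<and>
        same (under ([- 2] @ [int t]) \<union> scr (10 + 1)) {} M M')"
    by (rule runs_mono[OF table_layer_runs[OF \<open>par M\<close> t(2) prev]])
      (auto dest: sub_under elim!: same_mono)
next
  fix M assume M: "(\<forall>t<n + 1. \<forall>u<n. \<forall>x\<le>n. \<forall>i<n. tcell t u x i M) \<and> same (sub [- 2] \<union> scr 10) {} M0 M"
  have "par M" by (rule par_same[OF conjunct2[OF M] assms]) auto
  then show "tab M" using M by (simp add: tab_def less_Suc_eq_le)
qed auto


lemma tab_cell:
  "tab M \<Longrightarrow> t \<le> n \<Longrightarrow> u < n \<Longrightarrow> x \<le> n \<Longrightarrow> i < n \<Longrightarrow>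
    fst M [- 2, int t, int u, int x, int i] = of_bool (ps ! i \<in> ball t u x)"
  by (simp add: tab_def)

lemma tabD:
  assumes "tab M"
  shows "fst M [0, 0] = int n" "fst M [0, 2] = int h" "fst M [0, 4] = k"
    "fst M [- 4] = int m" "fst M [- 3] = int r"
    "i < n \<Longrightarrow> snd M [0, 0, int i] = fst (ps ! i)" "i < n \<Longrightarrow> snd M [0, 1, int i] = snd (ps ! i)"
    "i < n \<Longrightarrow> j < n \<Longrightarrow> fst M [0, 1, int i, int j] = of_bool ({ps ! i, ps ! j} \<in> edges G)"
    "i < h \<Longrightarrow> fst M [0, 2, int i] = int (hs ! i)"
    "i < h \<Longrightarrow> j < h \<Longrightarrow> fst M [0, 3, int i, int j] = of_bool ({hs ! i, hs ! j} \<in> edges H)"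
  using assms by (auto simp: tab_def par_def inp_def)

lemma r_le: "r \<le> n" "r \<le> m"
  by (simp_all add: r_def)

section \<open>The density test\<close>

lemma card_indices: "card {j. j < n \<and> B (ps ! j)} = card {q \<in> P. B q}"
proof -
  have "{q \<in> P. B q} = (!) ps ` {j. j < n \<and> B (ps ! j)}"
    unfolding ps(2)[symmetric] set_conv_nth by blast
  moreover have "inj_on ((!) ps) {j. j < n \<and> B (ps ! j)}"
    using ps(1) by (auto simp: inj_on_def nth_eq_iff_index_eq)
  ultimately show ?thesis by (simp add: card_image)
qed

lemma near_test_iff:
  assumes "tab M" "fst M [10] = int u" "fst M [12] = int j" "u < n" "j < n"
  shows "holds M near_test \<longleftrightarrow> near (1/2) (ps ! u) (ps ! j)"
proof -
  have half: "of_rat (1/2) = (1/2 :: real)" by (simp add: of_rat_divide)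
  have "\<bar>a - b\<bar> \<le> 1/2 \<longleftrightarrow> a \<le> b + 1/2 \<and> b \<le> a + 1/2" for a b :: real by linarith
  then show ?thesis
    unfolding near_def using assms tabD(6,7)[OF assms(1)] by (simp only:) (simp add: Let_def half)
qed

lemma dense_runs:
  assumes "tab M0"
  shows "runs N dense_com M0 (\<lambda>M'. fst M' [3] = (if \<exists>u<n. dense_pt m P (ps ! u) then 1 else fst M0 [3]) \<and>
    same (insert [3] (scr 10)) {} M0 M')"
  unfolding dense_com_def
proof (rule runs_For_flag)
  fix M assume s: "same (insert [3] (scr 10)) {} M0 M"
  have "tab M" by (rule tab_same[OF s assms]) auto
  then show "ival M cN = int n" by (simp add: tabD)
  fix u assume u: "u < n" "fst M [10] = int u"
  let ?c = "\<lambda>i. int (card {j. j < i \<and> near (1/2) (ps ! u) (ps ! j)})"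
  let ?R1 = "\<lambda>M1. fst M1 [11] = 0 \<and> same (scr 11) {} M M1"
  let ?R2 = "\<lambda>M1. fst M1 [11] = ?c n \<and> same (scr 11) {} M M1"
  let ?Q = "\<lambda>M'. fst M' [3] = (if dense_pt m P (ps ! u) then 1 else fst M [3]) \<and>
    same (insert [3] (scr (10 + 1))) {} M M'"
  have c1: "runs N (SetInt [IConst 11] (IConst 0)) M ?R1"
    by (rule runs_SetInt) (auto intro!: same_write_int)
  have c2: "runs N (For 12 cN (Cond near_test (SetInt [IConst 11] (isucc (V 11))) Skip)) M1 ?R2"
    if M1: "?R1 M1" for M1
  proof (rule runs_mono[OF runs_For[where R = "{[11]}" and R' = "{}"
        and I = "\<lambda>i M. fst M [11] = ?c i" and nb = n]])
    fix M2 assume s2: "same ({[11]} \<union> scr 12) {} M1 M2"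
    have s': "same (scr 11) {} M M2"
      by (rule same_trans_mono[OF conjunct2[OF M1] s2]) (auto intro: scr_antimono[THEN subsetD, rotated])
    have "tab M2" by (rule tab_same[OF s' \<open>tab M\<close>]) auto
    then show "ival M2 cN = int n" by (simp add: tabD)
    fix i assume i: "i < n" "fst M2 [12] = int i" "fst M2 [11] = ?c i"
    have "{j. j < Suc i \<and> near (1/2) (ps ! u) (ps ! j)} =
        (if near (1/2) (ps ! u) (ps ! i) then insert i {j. j < i \<and> near (1/2) (ps ! u) (ps ! j)}
         else {j. j < i \<and> near (1/2) (ps ! u) (ps ! j)})"
      by (auto simp: less_Suc_eq)
    then have "?c (Suc i) = (if near (1/2) (ps ! u) (ps ! i) then ?c i + 1 else ?c i)" by simp
    moreover have "holds M2 near_test \<longleftrightarrow> near (1/2) (ps ! u) (ps ! i)"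
      using near_test_iff[OF \<open>tab M2\<close> _ i(2) u(1) i(1)] same_int[OF s'] u(2) by simp
    ultimately show "runs N (Cond near_test (SetInt [IConst 11] (isucc (V 11))) Skip) M2
        (\<lambda>M'. fst M' [11] = ?c (Suc i) \<and> same ({[11]} \<union> scr (12 + 1)) {} M2 M')"
      using i(3) by (intro runs_Cond runs_SetInt runs_Skip) (auto intro!: same_write_int)
  next
    fix M2 assume *: "fst M2 [11] = ?c n \<and> same ({[11]} \<union> scr 12) {} M1 M2"
    show "?R2 M2"
      using * same_trans_mono[OF conjunct2[OF M1] conjunct2[OF *], of "scr 11" "{}"]
        scr_antimono[of 11 12] by auto
  next
    fix i and M2 M3 :: memory assume "fst M2 [11] = ?c i" "same (scr 12) {} M2 M3"
    then show "fst M3 [11] = ?c i" using same_int[of _ _ M2 M3 "[11]"] by simp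
  qed (use M1 in auto)
  have c3: "runs N (Cond (ILe cM (V 11)) (SetInt [IConst 3] (IConst 1)) Skip) M1 ?Q" if M1: "?R2 M1" for M1
  proof -
    have "fst M1 [- 4] = int m" using same_int[OF conjunct2[OF M1], of "[- 4]"] tabD(4)[OF \<open>tab M\<close>] by simp
    moreover have "fst M1 [3] = fst M [3]" using same_int[OF conjunct2[OF M1], of "[3]"] by simp
    moreover have "m \<le> card {j. j < n \<and> near (1/2) (ps ! u) (ps ! j)} \<longleftrightarrow> dense_pt m P (ps ! u)"
      by (simp add: dense_pt_def card_indices)
    moreover have "same (insert [3] (scr 11)) {} M M1" by (rule same_mono[OF conjunct2[OF M1]]) auto
    ultimately show ?thesis using M1
      by (intro runs_Cond runs_SetInt runs_Skip) (auto intro!: same_trans[of _ _ M M1] same_write_int)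
  qed
  show "runs N (Seq (SetInt [IConst 11] (IConst 0))
     (Seq (For 12 cN (Cond near_test (SetInt [IConst 11] (isucc (V 11))) Skip))
     (Cond (ILe cM (V 11)) (SetInt [IConst 3] (IConst 1)) Skip))) M ?Q"
    by (rule runs_Seq[OF c1], rule runs_Seq[OF c2 c3])
qed auto

section \<open>The test for far pairs\<close>

text \<open>Bridges the gap between \<open>far\<close>, where every point of the plane may be
  deleted, and the program, which deletes by index.\<close>

lemma nbh_outside:
  assumes "x \<notin> P" "u \<in> P"
  shows "nbh (edges G) {x} u t = nbh (edges G) {} u t"
proof (induction t)
  case (Suc t)
  have "q \<noteq> x" if "{b, q} \<in> edges G" for b q using that edges_P assms(1) by blast
  then show ?case using Suc by auto
qed simp

text \<open>The index \<open>n\<close> stands both for no deletion and for the deletion of a point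
  outside \<open>P\<close>.\<close>

lemma far_iff:
  assumes "u < n" "w < n"
  shows "far (edges G) n r (ps ! u) (ps ! w) \<longleftrightarrow> ps ! w \<notin> ball r u n \<and>
    \<not> (\<exists>x<n + 1. x \<noteq> u \<and> x \<noteq> w \<and> ps ! w \<notin> ball n u x)" (is "?l \<longleftrightarrow> ?r")
proof
  assume l: ?l
  have "ps ! w \<in> ball n u x" if "x < n + 1" "x \<noteq> u" "x \<noteq> w" for x
  proof (cases "x < n")
    case True
    then have "ps ! x \<noteq> ps ! u" "ps ! x \<noteq> ps ! w"
      using that assms ps(1) by (simp_all add: nth_eq_iff_index_eq)
    then show ?thesis using l True unfolding far_def ball_def by (simp del: split_paired_All)
  qed (use l in \<open>simp add: far_def ball_def\<close>)
  moreover have "ps ! w \<notin> ball r u n" using l by (simp add: far_def ball_def)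
  ultimately show ?r by blast
next
  assume r: ?r
  have all: "ps ! w \<in> ball n u n" using r assms by auto
  have "ps ! w \<in> nbh (edges G) {x} (ps ! u) n" if "x \<noteq> ps ! u" "x \<noteq> ps ! w" for x
  proof (cases "x \<in> P")
    case True
    then obtain i where i: "i < n" "x = ps ! i" using ps(2) by (metis in_set_conv_nth)
    then have "i \<noteq> u" "i \<noteq> w" using that by auto
    then have "ps ! w \<in> ball n u i" using r trans_less_add1[OF i(1), of 1] by blast
    then show ?thesis using i by (simp add: ball_def)
  next
    case False
    then show ?thesis using all nbh_outside nth_P assms(1) by (simp add: ball_def)
  qed
  then show ?l using r all by (simp add: far_def ball_def)
qed

lemma far_runs:
  assumes "tab M0"
  shows "runs N far_com M0 (\<lambda>M'. fst M' [3] =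
      (if \<exists>u<n. \<exists>w<n. far (edges G) n r (ps ! u) (ps ! w) then 1 else fst M0 [3]) \<and>
    same (insert [3] (scr 10)) {} M0 M')"
  unfolding far_com_def
proof (rule runs_For_flag)
  fix M assume s: "same (insert [3] (scr 10)) {} M0 M"
  have "tab M" by (rule tab_same[OF s assms]) auto
  then show "ival M cN = int n" by (simp add: tabD)
  fix u assume u: "u < n" "fst M [10] = int u"
  let ?inner = "Seq (SetInt [IConst 12] (IConst 1))
       (Seq (For 13 (isucc cN)
         (Cond (TAnd (TNot (ieq (V 13) (V 10))) (TAnd (TNot (ieq (V 13) (V 11)))
                 (ILe (ICell (aT cN (V 10) (V 13) (V 11))) (IConst 0))))
           (SetInt [IConst 12] (IConst 0)) Skip))
       (Cond (ILe (IConst 1) (V 12)) (SetInt [IConst 3] (IConst 1)) Skip))"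
  have "runs N (For 11 cN
     (Cond (ILe (ICell (aT cR (V 10) cN (V 11))) (IConst 0)) ?inner Skip)) M
    (\<lambda>M'. fst M' [3] = (if \<exists>w<n. far (edges G) n r (ps ! u) (ps ! w) then 1 else fst M [3]) \<and>
      same (insert [3] (scr 11)) {} M M')"
  proof (rule runs_For_flag)
    fix M1 assume s1: "same (insert [3] (scr 11)) {} M M1"
    have "tab M1" by (rule tab_same[OF s1 \<open>tab M\<close>]) auto
    then show "ival M1 cN = int n" by (simp add: tabD)
    fix w assume w: "w < n" "fst M1 [11] = int w"
    have u1: "fst M1 [10] = int u" using same_int[OF s1] u by simp
    let ?B = "\<lambda>x. x \<noteq> u \<and> x \<noteq> w \<and> ps ! w \<notin> ball n u x"
    let ?Q = "\<lambda>M'. fst M' [3] = (if far (edges G) n r (ps ! u) (ps ! w) then 1 else fst M1 [3]) \<and>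
      same (insert [3] (scr (11 + 1))) {} M1 M'"
    have t: "fst M1 [- 2, int r, int u, int n, int w] = of_bool (ps ! w \<in> ball r u n)"
      using tab_cell[OF \<open>tab M1\<close>] r_le(1) u(1) w(1) by simp
    show "runs N (Cond (ILe (ICell (aT cR (V 10) cN (V 11))) (IConst 0)) ?inner Skip) M1 ?Q"
    proof (rule runs_Cond)
      assume "\<not> holds M1 (ILe (ICell (aT cR (V 10) cN (V 11))) (IConst 0))"
      then have "ps ! w \<in> ball r u n"
        using t u1 w(2) tabD(1,5)[OF \<open>tab M1\<close>]
        by (cases "ps ! w \<in> ball r u n") auto
      then show "runs N Skip M1 ?Q" using u(1) w(1) by (intro runs_Skip) (simp add: far_iff)
    next
      assume "holds M1 (ILe (ICell (aT cR (V 10) cN (V 11))) (IConst 0))"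
      then have notin: "ps ! w \<notin> ball r u n"
        using t u1 w(2) tabD(1,5)[OF \<open>tab M1\<close>]
        by (cases "ps ! w \<in> ball r u n") auto
      let ?R1 = "\<lambda>M2. fst M2 [12] = 1 \<and> same (scr 12) {} M1 M2"
      let ?R2 = "\<lambda>M2. fst M2 [12] = (if \<exists>x<n + 1. ?B x then 0 else 1) \<and> same (scr 12) {} M1 M2"
      have c1: "runs N (SetInt [IConst 12] (IConst 1)) M1 ?R1"
        by (rule runs_SetInt) (auto intro!: same_write_int)
      have c2: "runs N (For 13 (isucc cN)
         (Cond (TAnd (TNot (ieq (V 13) (V 10))) (TAnd (TNot (ieq (V 13) (V 11)))
                 (ILe (ICell (aT cN (V 10) (V 13) (V 11))) (IConst 0))))
           (SetInt [IConst 12] (IConst 0)) Skip)) M2 ?R2" if M2: "?R1 M2" for M2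
      \<comment> \<open>A search with value 0: the flag starts at 1 and falls when a separating
        vertex is found.\<close>
      proof (rule runs_mono[OF runs_For_flag[where f = 12 and v = 0 and B = ?B and nb = "n + 1"]])
        fix M3 assume s3: "same (insert [12] (scr 13)) {} M2 M3"
        have s': "same (scr 12) {} M1 M3"
          by (rule same_trans_mono[OF conjunct2[OF M2] s3])
            (auto intro: scr_antimono[THEN subsetD, rotated])
        have "tab M3" by (rule tab_same[OF s' \<open>tab M1\<close>]) auto
        then show "ival M3 (isucc cN) = int (n + 1)" by (simp add: tabD)
        fix x assume x: "x < n + 1" "fst M3 [13] = int x"
        have "fst M3 [- 2, int n, int u, int x, int w] = of_bool (ps ! w \<in> ball n u x)"
          using tab_cell[OF \<open>tab M3\<close>] u(1) w(1) x(1) by simp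
        then have "holds M3 (TAnd (TNot (ieq (V 13) (V 10))) (TAnd (TNot (ieq (V 13) (V 11)))
                 (ILe (ICell (aT cN (V 10) (V 13) (V 11))) (IConst 0)))) \<longleftrightarrow> ?B x"
          using same_int[OF s'] u1 w(2) x(2) tabD(1)[OF \<open>tab M3\<close>] by auto
        then show "runs N (Cond (TAnd (TNot (ieq (V 13) (V 10))) (TAnd (TNot (ieq (V 13) (V 11)))
                 (ILe (ICell (aT cN (V 10) (V 13) (V 11))) (IConst 0))))
           (SetInt [IConst 12] (IConst 0)) Skip) M3
          (\<lambda>M'. fst M' [12] = (if ?B x then 0 else fst M3 [12]) \<and>
            same (insert [12] (scr (13 + 1))) {} M3 M')"
          by (intro runs_Cond runs_SetInt runs_Skip) (auto intro!: same_write_int)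
      next
        fix M3 assume *: "fst M3 [12] = (if \<exists>x<n + 1. ?B x then 0 else fst M2 [12]) \<and>
          same (insert [12] (scr 13)) {} M2 M3"
        have "same (scr 12) {} M1 M3"
          by (rule same_trans_mono[OF conjunct2[OF M2] conjunct2[OF *]])
            (auto intro: scr_antimono[THEN subsetD, rotated])
        then show "?R2 M3" using * M2 by (simp cong: if_cong)
      qed auto
      have c3: "runs N (Cond (ILe (IConst 1) (V 12)) (SetInt [IConst 3] (IConst 1)) Skip) M2 ?Q"
        if M2: "?R2 M2" for M2
      proof -
        have "fst M2 [3] = fst M1 [3]" using same_int[OF conjunct2[OF M2], of "[3]"] by simp
        moreover have "far (edges G) n r (ps ! u) (ps ! w) \<longleftrightarrow> \<not> (\<exists>x<n + 1. ?B x)"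
          using far_iff[OF u(1) w(1)] notin by blast
        moreover have "same (insert [3] (scr 12)) {} M1 M2" by (rule same_mono[OF conjunct2[OF M2]]) auto
        ultimately show ?thesis using conjunct1[OF M2]
          by (intro runs_Cond runs_SetInt runs_Skip)
            (auto split: if_splits intro!: same_trans[of _ _ M1 M2] same_write_int)
      qed
      show "runs N ?inner M1 ?Q"
        by (rule runs_Seq[OF c1], rule runs_Seq[OF c2 c3])
    qed
  qed auto
  then show "runs N (For 11 cN
     (Cond (ILe (ICell (aT cR (V 10) cN (V 11))) (IConst 0)) ?inner Skip)) M
    (\<lambda>M'. fst M' [3] = (if \<exists>w<n. far (edges G) n r (ps ! u) (ps ! w) then 1 else fst M [3]) \<and>
      same (insert [3] (scr (10 + 1))) {} M M')"
    by simp
qed auto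

definition special :: bool where
  "special \<longleftrightarrow> (case prob of Subgraph_Isomorphism \<Rightarrow> k \<le> 0
     | Longest_Cycle \<Rightarrow> \<exists>u<n. \<exists>w<n. far (edges G) n r (ps ! u) (ps ! w))"

lemma special_runs:
  assumes "tab M0"
  shows "runs N (special_com prob) M0 (\<lambda>M'. fst M' [3] = (if special then 1 else fst M0 [3]) \<and>
    same (insert [3] (scr 10)) {} M0 M')"
proof (cases prob)
  case Subgraph_Isomorphism
  then have "special \<longleftrightarrow> k \<le> 0" "special_com prob =
      Cond (ILe cK (IConst 0)) (SetInt [IConst 3] (IConst 1)) Skip" unfolding special_def by simp_all
  then show ?thesis
    using tabD(3)[OF assms]
    by (simp only:) (intro runs_Cond runs_SetInt runs_Skip; auto intro!: same_write_int)
next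
  case Longest_Cycle
  then have "special \<longleftrightarrow> (\<exists>u<n. \<exists>w<n. far (edges G) n r (ps ! u) (ps ! w))"
    "special_com prob = far_com" unfolding special_def by simp_all
  then show ?thesis using far_runs[OF assms] by (simp only:)
qed


section \<open>Writing the pattern and the clique\<close>

definition pattern_at :: "int \<Rightarrow> memory \<Rightarrow> bool" where
  "pattern_at j M \<longleftrightarrow> fst M [2, j, 2] = int h \<and> (\<forall>i<h. fst M [2, j, 2, int i] = int (hs ! i)) \<and>
     (\<forall>i<h. \<forall>i'<h. fst M [2, j, 3, int i, int i'] = of_bool ({hs ! i, hs ! i'} \<in> edges H)) \<and>
     fst M [2, j, 4] = k"

text \<open>The frame names just the three areas of the pattern, so the points stored below
  \<open>[2, j, 0]\<close> and \<open>[2, j, 1]\<close> survive. \<open>J\<close> is either a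
  constant or the counter of an outer loop, hence stable throughout.\<close>

lemma pattern_runs:
  assumes "tab M0"
    and J: "\<And>M. same (sub [2] \<union> scr 12) {} M0 M \<Longrightarrow> ival M J = j"
  shows "runs N (pattern_com J) M0 (\<lambda>M'. pattern_at j M' \<and>
    same (under [2, j, 2] \<union> under [2, j, 3] \<union> under [2, j, 4] \<union> scr 12) {} M0 M')"
proof -
  let ?D = "under [2, j, 2] \<union> under [2, j, 3] \<union> under [2, j, 4] \<union> scr 12"
  have subD: "?D \<subseteq> sub [2] \<union> scr 12" by (auto simp: under_def sub_def)
  have Jj: "ival M J = j" if "same ?D {} M0 M" for M
    using J[OF same_mono[OF that subD]] by simp
  have tabM: "tab M" if "same ?D {} M0 M" for M
    by (rule tab_same[OF that assms(1)]) auto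
  let ?R1 = "\<lambda>M. fst M [2, j, 2] = int h \<and> same ?D {} M0 M"
  let ?R2 = "\<lambda>M. fst M [2, j, 4] = k \<and> ?R1 M"
  let ?R3 = "\<lambda>M. (\<forall>i<h. fst M [2, j, 2, int i] = int (hs ! i)) \<and> ?R2 M"
  have c1: "runs N (SetInt [IConst 2, J, IConst 2] cH) M0 ?R1"
    using Jj[of M0] tabD(2)[OF assms(1)] by (intro runs_SetInt) (auto intro!: same_write_int)
  have c2: "runs N (SetInt [IConst 2, J, IConst 4] cK) M ?R2" if "?R1 M" for M
    using that Jj[of M] tabD(3)[OF tabM, of M]
    by (intro runs_SetInt) (auto intro!: same_trans[of _ _ M0 M] same_write_int)
  have c3: "runs N (For 12 cH (SetInt [IConst 2, J, IConst 2, V 12] (ICell [IConst 0, IConst 2, V 12]))) M ?R3"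
    if M: "?R2 M" for M
  proof (rule runs_mono[OF runs_For_ints[where p = "[2, j, 2]" and nb = h
        and Q = "\<lambda>i M. fst M [2, j, 2, int i] = int (hs ! i)"]])
    fix M1 assume s1: "same (sub [2, j, 2] \<union> scr 12) {} M M1"
    have s: "same ?D {} M0 M1" by (rule same_trans_mono[OF _ s1]) (use M in \<open>auto dest: sub_under simp: sub_def\<close>)
    show "ival M1 cH = int h" using tabD(2)[OF tabM[OF s]] by simp
    fix i assume "i < h" "fst M1 [12] = int i"
    then show "runs N (SetInt [IConst 2, J, IConst 2, V 12] (ICell [IConst 0, IConst 2, V 12])) M1
      (\<lambda>M'. fst M' [2, j, 2, int i] = int (hs ! i) \<and>
        same (under ([2, j, 2] @ [int i]) \<union> scr (12 + 1)) {} M1 M')"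
      using Jj[OF s] tabD(9)[OF tabM[OF s]]
      by (intro runs_SetInt) (auto intro!: same_write_int)
  next
    fix M1 assume M1: "(\<forall>i<h. fst M1 [2, j, 2, int i] = int (hs ! i)) \<and> same (sub [2, j, 2] \<union> scr 12) {} M M1"
    have "same ?D {} M0 M1"
      by (rule same_trans_mono[OF _ conjunct2[OF M1]]) (use M in \<open>auto dest: sub_under simp: sub_def\<close>)
    then show "?R3 M1" using M M1 same_int[OF conjunct2[OF M1]] by simp
  qed auto
  have c4: "runs N (For 12 cH (For 13 cH
       (SetInt [IConst 2, J, IConst 3, V 12, V 13] (ICell [IConst 0, IConst 3, V 12, V 13])))) M
     (\<lambda>M'. pattern_at j M' \<and> same ?D {} M0 M')" if M: "?R3 M" for M
  proof (rule runs_mono[OF runs_For_ints[where p = "[2, j, 3]" and nb = h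
        and Q = "\<lambda>i M. \<forall>i'<h. fst M [2, j, 3, int i, int i'] = of_bool ({hs ! i, hs ! i'} \<in> edges H)"]])
    fix M1 assume s1: "same (sub [2, j, 3] \<union> scr 12) {} M M1"
    have s: "same ?D {} M0 M1"
      by (rule same_trans_mono[OF _ s1]) (use M in \<open>auto dest: sub_under simp: sub_def\<close>)
    show "ival M1 cH = int h" using tabD(2)[OF tabM[OF s]] by simp
    fix i assume i: "i < h" "fst M1 [12] = int i"
    have "runs N (For 13 cH
       (SetInt [IConst 2, J, IConst 3, V 12, V 13] (ICell [IConst 0, IConst 3, V 12, V 13]))) M1
      (\<lambda>M'. (\<forall>i'<h. fst M' [2, j, 3, int i, int i'] = of_bool ({hs ! i, hs ! i'} \<in> edges H)) \<and>
        same (sub [2, j, 3, int i] \<union> scr 13) {} M1 M')"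
    proof (rule runs_For_ints)
      fix M2 assume s2: "same (sub [2, j, 3, int i] \<union> scr 13) {} M1 M2"
      have s': "same ?D {} M0 M2" by (rule same_trans_mono[OF s s2]) (auto simp: under_def sub_def scr_def)
      then show "ival M2 cH = int h" using tabD(2) tabM by simp
      fix i' assume "i' < h" "fst M2 [13] = int i'"
      then show "runs N (SetInt [IConst 2, J, IConst 3, V 12, V 13] (ICell [IConst 0, IConst 3, V 12, V 13])) M2
        (\<lambda>M'. fst M' [2, j, 3, int i, int i'] = of_bool ({hs ! i, hs ! i'} \<in> edges H) \<and>
          same (under ([2, j, 3, int i] @ [int i']) \<union> scr (13 + 1)) {} M2 M')"
        using Jj[OF s'] tabD(10)[OF tabM[OF s']] i same_int[OF s2, of "[12]"]
        by (intro runs_SetInt) (auto intro!: same_write_int)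
    qed auto
    then show "runs N (For 13 cH
       (SetInt [IConst 2, J, IConst 3, V 12, V 13] (ICell [IConst 0, IConst 3, V 12, V 13]))) M1
      (\<lambda>M'. (\<forall>i'<h. fst M' [2, j, 3, int i, int i'] = of_bool ({hs ! i, hs ! i'} \<in> edges H)) \<and>
        same (under ([2, j, 3] @ [int i]) \<union> scr (12 + 1)) {} M1 M')"
      by (rule runs_mono) (auto dest: sub_under elim!: same_mono)
  next
    fix M1 assume M1: "(\<forall>i<h. \<forall>i'<h. fst M1 [2, j, 3, int i, int i'] = of_bool ({hs ! i, hs ! i'} \<in> edges H)) \<and>
      same (sub [2, j, 3] \<union> scr 12) {} M M1"
    have "same ?D {} M0 M1"
      by (rule same_trans_mono[OF _ conjunct2[OF M1]]) (use M in \<open>auto dest: sub_under simp: sub_def\<close>)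
    then show "pattern_at j M1 \<and> same ?D {} M0 M1"
      using M M1 same_int[OF conjunct2[OF M1]] by (simp add: pattern_at_def)
  qed auto
  show ?thesis
    unfolding pattern_com_def
    by (rule runs_Seq[OF c1], rule runs_Seq[OF c2], assumption, rule runs_Seq[OF c3 c4])
qed

definition points_at :: "nat \<Rightarrow> point list \<Rightarrow> memory \<Rightarrow> bool" where
  "points_at j bs M \<longleftrightarrow>
     fst M [2, int j, 0] = int (length bs) \<and>
     (\<forall>a<length bs. \<forall>b<length bs. fst M [2, int j, 1, int a, int b] =
        of_bool ({bs ! a, bs ! b} \<in> edges (geometric_graph s (set bs)))) \<and>
     (\<forall>a<length bs. snd M [2, int j, 0, int a] = fst (bs ! a)) \<and>
     (\<forall>a<length bs. snd M [2, int j, 1, int a] = snd (bs ! a))"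

lemma stores_output_instance:
  assumes "points_at j bs M" "pattern_at (int j) M" "distinct bs"
  shows "stores_instance M [2, int j] (geometric_graph s (set bs), set bs, H, k)"
  unfolding stores_instance_iff
  using assms hs
  by (intro exI[of _ bs] exI[of _ hs]) (simp add: points_at_def pattern_at_def)

definition cpts :: "point list" where
  "cpts = map (\<lambda>i. ((1/2) ^ i, 0)) [0..<m]"

lemma cpts: "length cpts = m" "distinct cpts" "i < m \<Longrightarrow> cpts ! i = ((1/2) ^ i, 0)"
  by (auto simp: cpts_def distinct_map inj_on_def power_inject_exp')

lemma cpts_close: "p \<in> set cpts \<Longrightarrow> q \<in> set cpts \<Longrightarrow> close s p q"
proof (rule near_imp_close)
  have "0 \<le> (1/2 :: real) ^ i \<and> (1/2 :: real) ^ i \<le> 1" for i by (simp add: power_le_one)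
  then have "\<bar>(1/2 :: real) ^ i - (1/2) ^ j\<bar> \<le> 1" for i j by (smt (verit))
  moreover assume "p \<in> set cpts" "q \<in> set cpts"
  ultimately show "near 1 p q" by (auto simp: cpts_def near_def)
qed

lemma cpts_edge:
  "a < m \<Longrightarrow> b < m \<Longrightarrow> {cpts ! a, cpts ! b} \<in> edges (geometric_graph s (set cpts)) \<longleftrightarrow> a \<noteq> b"
  using cpts(1,2) cpts_close[of "cpts ! a" "cpts ! b"] nth_mem[of a cpts] nth_mem[of b cpts]
  by (simp add: edge_geometric_graph nth_eq_iff_index_eq)

text \<open>These loops run \<open>m\<close> times, and \<open>m\<close> grows with \<open>k\<close>
  rather than with the input; \<open>mN\<close> keeps them within the uniform loop bound.\<close>

lemma clique_runs:
  assumes "tab M0" and mN: "m \<le> N + 3"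
  shows "runs N clique_com M0 (\<lambda>M'. fst M' [1] = 1 \<and>
    stores_instance M' [2, 0] (geometric_graph s (set cpts), set cpts, H, k))"
proof -
  let ?D = "insert [1] (sub [2] \<union> scr 12)" and ?D' = "sub [2]"
  have tabM: "tab M" if "same ?D ?D' M0 M" for M
    by (rule tab_same[OF that assms(1)]) auto
  have half: "of_rat (1/2) = (1/2 :: real)" by (simp add: of_rat_divide)
  let ?R1 = "\<lambda>M. fst M [1] = 1 \<and> same ?D ?D' M0 M"
  let ?R2 = "\<lambda>M. fst M [2, 0, 0] = int m \<and> ?R1 M"
  let ?R3 = "\<lambda>M. (\<forall>a<m. \<forall>b<m. fst M [2, 0, 1, int a, int b] = of_bool (a \<noteq> b)) \<and> ?R2 M"
  let ?R4 = "\<lambda>M. (\<forall>a<m. snd M [2, 0, 0, int a] = (1/2) ^ a) \<and> ?R3 M"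
  let ?R5 = "\<lambda>M. (\<forall>a<m. snd M [2, 0, 1, int a] = 0) \<and> ?R4 M"
  have c1: "runs N (SetInt [IConst 1] (IConst 1)) M0 ?R1"
    by (intro runs_SetInt) (auto intro!: same_write_int)
  have c2: "runs N (SetInt [IConst 2, IConst 0, IConst 0] cM) M ?R2" if "?R1 M" for M
    using that tabD(4)[OF tabM, of M]
    by (intro runs_SetInt) (auto intro!: same_trans[of _ _ M0 M] same_write_int)
  let ?c = "Cond (ieq (V 12) (V 13))
       (SetInt [IConst 2, IConst 0, IConst 1, V 12, V 13] (IConst 0))
       (SetInt [IConst 2, IConst 0, IConst 1, V 12, V 13] (IConst 1))"
  have c3: "runs N (For 12 cM (For 13 cM ?c)) M ?R3" if M: "?R2 M" for M
  proof (rule runs_mono[OF runs_For_ints[where p = "[2, 0, 1]" and nb = m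
        and Q = "\<lambda>a M. \<forall>b<m. fst M [2, 0, 1, int a, int b] = of_bool (a \<noteq> b)"]])
    fix M1 assume s1: "same (sub [2, 0, 1] \<union> scr 12) {} M M1"
    have s: "same ?D ?D' M0 M1" by (rule same_trans_mono[OF _ s1]) (use M in \<open>auto dest: sub_under simp: sub_def\<close>)
    show "ival M1 cM = int m" using tabD(4)[OF tabM[OF s]] by simp
    fix a assume a: "a < m" "fst M1 [12] = int a"
    have "runs N (For 13 cM ?c) M1 (\<lambda>M'. (\<forall>b<m. fst M' [2, 0, 1, int a, int b] = of_bool (a \<noteq> b)) \<and>
        same (sub [2, 0, 1, int a] \<union> scr 13) {} M1 M')"
    proof (rule runs_For_ints)
      fix M2 assume s2: "same (sub [2, 0, 1, int a] \<union> scr 13) {} M1 M2"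
      have "same ?D ?D' M0 M2" by (rule same_trans_mono[OF s s2]) (auto simp: sub_def scr_def)
      then show "ival M2 cM = int m" using tabD(4) tabM by simp
      fix b assume "b < m" "fst M2 [13] = int b"
      then show "runs N ?c M2 (\<lambda>M'. fst M' [2, 0, 1, int a, int b] = of_bool (a \<noteq> b) \<and>
          same (under ([2, 0, 1, int a] @ [int b]) \<union> scr (13 + 1)) {} M2 M')"
        using a same_int[OF s2, of "[12]"]
        by (intro runs_Cond runs_SetInt) (auto intro!: same_write_int)
    qed (use mN in auto)
    then show "runs N (For 13 cM ?c) M1 (\<lambda>M'. (\<forall>b<m. fst M' [2, 0, 1, int a, int b] = of_bool (a \<noteq> b)) \<and>
        same (under ([2, 0, 1] @ [int a]) \<union> scr (12 + 1)) {} M1 M')"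
      by (rule runs_mono) (auto dest: sub_under elim!: same_mono)
  next
    fix M1 assume M1: "(\<forall>a<m. \<forall>b<m. fst M1 [2, 0, 1, int a, int b] = of_bool (a \<noteq> b)) \<and>
      same (sub [2, 0, 1] \<union> scr 12) {} M M1"
    have "same ?D ?D' M0 M1"
      by (rule same_trans_mono[OF _ conjunct2[OF M1]]) (use M in \<open>auto dest: sub_under simp: sub_def\<close>)
    then show "?R3 M1" using M M1 same_int[OF conjunct2[OF M1]] by simp
  qed (use mN in auto)
  let ?d = "Cond (ILe (V 12) (IConst 0))
       (SetReal [IConst 2, IConst 0, IConst 0, V 12] (LConst 1))
       (SetReal [IConst 2, IConst 0, IConst 0, V 12]
         (LScale (1/2) (LCell [IConst 2, IConst 0, IConst 0, ipred (V 12)])))"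
  have c4: "runs N (For 12 cM ?d) M ?R4" if M: "?R3 M" for M
  proof (rule runs_mono[OF runs_For_reals[where p = "[2, 0, 0]" and nb = m
        and Q = "\<lambda>a M. snd M [2, 0, 0, int a] = (1/2) ^ a"]])
    fix M1 assume s1: "same (scr 12) (sub [2, 0, 0]) M M1"
    have s: "same ?D ?D' M0 M1" by (rule same_trans_mono[OF _ s1]) (use M in \<open>auto dest: sub_under simp: sub_def\<close>)
    show "ival M1 cM = int m" using tabD(4)[OF tabM[OF s]] by simp
    fix a assume a: "a < m" "fst M1 [12] = int a" "\<forall>b<a. snd M1 [2, 0, 0, int b] = (1/2) ^ b"
    \<comment> \<open>The previous point is halved. Index 0 is treated separately, as there is
      nothing to read before it.\<close>
    have "(1/2) * snd M1 [2, 0, 0, int a - 1] = (1/2) ^ a" if "0 < a"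
    proof -
      have "snd M1 [2, 0, 0, int (a - 1)] = (1/2) ^ (a - 1)" using spec[OF a(3), of "a - 1"] that by simp
      then show ?thesis using that by (simp add: of_nat_diff power_eq_if)
    qed
    then show "runs N ?d M1 (\<lambda>M'. snd M' [2, 0, 0, int a] = (1/2) ^ a \<and>
        same (scr (12 + 1)) (under ([2, 0, 0] @ [int a])) M1 M')"
      using a by (intro runs_Cond runs_SetReal) (auto simp: half intro!: same_write_real)
  next
    fix M1 assume M1: "(\<forall>a<m. snd M1 [2, 0, 0, int a] = (1/2) ^ a) \<and> same (scr 12) (sub [2, 0, 0]) M M1"
    have "same ?D ?D' M0 M1"
      by (rule same_trans_mono[OF _ conjunct2[OF M1]]) (use M in \<open>auto dest: sub_under simp: sub_def\<close>)
    then show "?R4 M1" using M M1 same_int[OF conjunct2[OF M1]] by simp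
  qed (use mN in auto)
  have c5: "runs N (For 12 cM (SetReal [IConst 2, IConst 0, IConst 1, V 12] (LConst 0))) M ?R5"
    if M: "?R4 M" for M
  proof (rule runs_mono[OF runs_For_reals[where p = "[2, 0, 1]" and nb = m
        and Q = "\<lambda>a M. snd M [2, 0, 1, int a] = 0"]])
    fix M1 assume s1: "same (scr 12) (sub [2, 0, 1]) M M1"
    have s: "same ?D ?D' M0 M1" by (rule same_trans_mono[OF _ s1]) (use M in \<open>auto dest: sub_under simp: sub_def\<close>)
    show "ival M1 cM = int m" using tabD(4)[OF tabM[OF s]] by simp
    fix a assume "a < m" "fst M1 [12] = int a"
    then show "runs N (SetReal [IConst 2, IConst 0, IConst 1, V 12] (LConst 0)) M1
      (\<lambda>M'. snd M' [2, 0, 1, int a] = 0 \<and> same (scr (12 + 1)) (under ([2, 0, 1] @ [int a])) M1 M')"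
      by (intro runs_SetReal) (auto intro!: same_write_real)
  next
    fix M1 assume M1: "(\<forall>a<m. snd M1 [2, 0, 1, int a] = 0) \<and> same (scr 12) (sub [2, 0, 1]) M M1"
    have "same ?D ?D' M0 M1"
      by (rule same_trans_mono[OF _ conjunct2[OF M1]]) (use M in \<open>auto dest: sub_under simp: sub_def\<close>)
    then show "?R5 M1"
      using M M1 same_int[OF conjunct2[OF M1]] same_real[OF conjunct2[OF M1]] by simp
  qed (use mN in auto)
  have c6: "runs N (pattern_com (IConst 0)) M (\<lambda>M'. fst M' [1] = 1 \<and>
    stores_instance M' [2, 0] (geometric_graph s (set cpts), set cpts, H, k))" if M: "?R5 M" for M
  proof (rule runs_mono[OF pattern_runs[where j = 0]])
    show "tab M" using M tabM by blast
    fix M1 assume M1: "pattern_at 0 M1 \<and>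
      same (under [2, 0, 2] \<union> under [2, 0, 3] \<union> under [2, 0, 4] \<union> scr 12) {} M M1"
    have "points_at 0 cpts M1"
      using M same_int[OF conjunct2[OF M1]] same_real[OF conjunct2[OF M1]] cpts cpts_edge
      by (simp add: points_at_def)
    then show "fst M1 [1] = 1 \<and>
      stores_instance M1 [2, 0] (geometric_graph s (set cpts), set cpts, H, k)"
      using stores_output_instance[of 0 cpts M1] M1 M same_int[OF conjunct2[OF M1], of "[1]"] cpts(2) by simp
  qed auto
  show ?thesis
    unfolding clique_com_def
    by (rule runs_Seq[OF c1], rule runs_Seq[OF c2], assumption, rule runs_Seq[OF c3], assumption,
        rule runs_Seq[OF c4], assumption, rule runs_Seq[OF c5 c6])
qed

section \<open>Writing a ball\<close>

text \<open>The parameter \<open>i\<close> serves the loop invariant: it is the list collected after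
  the first \<open>i\<close> points have been examined.\<close>

definition members :: "nat \<Rightarrow> nat \<Rightarrow> nat list" where
  "members u i = filter (\<lambda>j. ps ! j \<in> ball r u n) [0..<i]"

definition bpts :: "nat \<Rightarrow> point list" where
  "bpts u = map ((!) ps) (members u n)"

lemma members_less: "a < length (members u n) \<Longrightarrow> members u n ! a < n"
  using nth_mem[of a "members u n"] by (auto simp: members_def)

lemma length_members: "length (members u n) \<le> n"
  unfolding members_def by (metis diff_zero length_filter_le length_upt)

lemma set_bpts:
  assumes "u < n"
  shows "set (bpts u) = ball r u n"
proof -
  have "set (bpts u) = {q \<in> set ps. q \<in> ball r u n}"
    unfolding set_conv_nth[of ps] by (auto simp: bpts_def members_def)
  then show ?thesis using ball_subset[OF assms] ps(2) by blast
qed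

lemma distinct_bpts: "distinct (bpts u)"
  using ps(1) by (auto simp: bpts_def members_def distinct_map inj_on_def nth_eq_iff_index_eq)

text \<open>Balls are induced subgraphs, so the program may copy entries of the input
  matrix.\<close>

lemma bpts_edge:
  assumes "u < n" "a < length (bpts u)" "b < length (bpts u)"
  shows "{bpts u ! a, bpts u ! b} \<in> edges (geometric_graph s (set (bpts u))) \<longleftrightarrow>
    {bpts u ! a, bpts u ! b} \<in> edges G"
  using nth_mem[OF assms(2)] nth_mem[OF assms(3)] ball_subset[OF assms(1), of r n] set_bpts[OF assms(1)]
  unfolding G(1) edge_geometric_graph by blast

text \<open>What must persist while a ball is written: the counter \<open>[10]\<close> of the
  enclosing loop and the member list below \<open>[11]\<close>, both out of reach of
  \<open>scr 12\<close>.\<close>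

definition lst :: "nat \<Rightarrow> memory \<Rightarrow> bool" where
  "lst u M \<longleftrightarrow> tab M \<and> fst M [10] = int u \<and> fst M [11] = int (length (members u n)) \<and>
     (\<forall>a<length (members u n). fst M [11, int a] = int (members u n ! a))"

lemma lst_same:
  assumes "same D D' M M'" "lst u M" "D \<subseteq> sub [2] \<union> scr 12" "D' \<subseteq> sub [2]"
  shows "lst u M'"
proof -
  have s: "same (sub [2] \<union> scr 12) (sub [2]) M M'" by (rule same_mono[OF assms(1,3,4)])
  have "tab M'" by (rule tab_same[OF s]) (use assms(2) in \<open>auto simp: lst_def\<close>)
  then show ?thesis using assms(2) same_int[OF s] by (simp add: lst_def)
qed

lemma ball_runs:
  assumes "tab M0" and u: "fst M0 [10] = int u" "u < n"
  shows "runs N ball_com M0 (\<lambda>M'.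
    stores_instance M' [2, int u] (geometric_graph s (set (bpts u)), set (bpts u), H, k) \<and>
    same (under [2, int u] \<union> scr 11) (under [2, int u]) M0 M')"
proof -
  let ?l = "length (members u n)"
  let ?D = "under [2, int u] \<union> scr 11" and ?D' = "under [2, int u]"
  let ?I = "\<lambda>i M. fst M [11] = int (length (members u i)) \<and>
    (\<forall>a<length (members u i). fst M [11, int a] = int (members u i ! a))"
  let ?R1 = "\<lambda>M. fst M [11] = 0 \<and> same ?D ?D' M0 M"
  let ?R2 = "\<lambda>M. lst u M \<and> same ?D ?D' M0 M"
  let ?R3 = "\<lambda>M. fst M [2, int u, 0] = int ?l \<and> ?R2 M"
  let ?R4 = "\<lambda>M. (\<forall>a<?l. \<forall>b<?l. fst M [2, int u, 1, int a, int b] =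
    of_bool ({bpts u ! a, bpts u ! b} \<in> edges G)) \<and> ?R3 M"
  let ?R5 = "\<lambda>M. (\<forall>a<?l. snd M [2, int u, 0, int a] = fst (bpts u ! a)) \<and> ?R4 M"
  let ?R6 = "\<lambda>M. (\<forall>a<?l. snd M [2, int u, 1, int a] = snd (bpts u ! a)) \<and> ?R5 M"
  have lN: "?l \<le> N + 3" using length_members[of u] by simp
  \<comment> \<open>All phases after the collection of members write only below
    \<open>[2, int u]\<close> and to \<open>scr 12\<close>, so this one fact serves each of
    them.\<close>
  have R2_same: "?R2 M'" if "?R2 M" "same E E' M M'" "E \<subseteq> sub [2, int u] \<union> scr 12" "E' \<subseteq> sub [2, int u]"
    for M M' E E'
  proof
    show "lst u M'"
      by (rule lst_same[OF that(2)]) (use that in \<open>auto simp: sub_def\<close>)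
    show "same ?D ?D' M0 M'"
      by (rule same_trans_mono[OF conjunct2[OF that(1)] that(2)])
        (use that(3,4) scr_antimono[of 11 12] in \<open>auto dest: sub_under\<close>)
  qed
  have lstD: "fst M [10] = int u" "fst M [11] = int ?l" "tab M"
    "a < ?l \<Longrightarrow> fst M [11, int a] = int (members u n ! a)" if "lst u M" for M a
    using that by (auto simp: lst_def)
  have c1: "runs N (SetInt [IConst 11] (IConst 0)) M0 ?R1"
    by (intro runs_SetInt) (auto intro!: same_write_int)
  let ?c = "Cond (ILe (IConst 1) (ICell (aT cR (V 10) cN (V 12))))
       (Seq (SetInt [IConst 11, V 11] (V 12)) (SetInt [IConst 11] (isucc (V 11)))) Skip"
  have c2: "runs N (For 12 cN ?c) M ?R2" if M: "?R1 M" for M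
  proof (rule runs_mono[OF runs_For[where R = "under [11]" and R' = "{}" and I = ?I and nb = n]])
    fix M1 assume s1: "same (under [11] \<union> scr 12) {} M M1"
    have s0: "same ?D ?D' M0 M1"
      by (rule same_trans_mono[OF conjunct2[OF M] s1]) (auto simp: scr_def under_def)
    have "tab M1" by (rule tab_same[OF s0 assms(1)]) auto
    then show "ival M1 cN = int n" using tabD(1) by simp
    fix i assume i: "i < n" "fst M1 [12] = int i" "?I i M1"
    have "fst M1 [10] = int u" using same_int[OF s0] u by simp
    moreover have "fst M1 [- 2, int r, int u, int n, int i] = of_bool (ps ! i \<in> ball r u n)"
      using tab_cell[OF \<open>tab M1\<close> r_le(1) u(2) _ i(1)] by simp
    ultimately have test: "holds M1 (ILe (IConst 1) (ICell (aT cR (V 10) cN (V 12)))) \<longleftrightarrow> ps ! i \<in> ball r u n"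
      using tabD(1,5)[OF \<open>tab M1\<close>] i(2) by simp
    have mem: "members u (Suc i) = (if ps ! i \<in> ball r u n then members u i @ [i] else members u i)"
      by (simp add: members_def)
    show "runs N ?c M1 (\<lambda>M'. ?I (Suc i) M' \<and> same (under [11] \<union> scr (12 + 1)) {} M1 M')"
    proof (rule runs_Cond)
      assume "holds M1 (ILe (IConst 1) (ICell (aT cR (V 10) cN (V 12))))"
      then have "members u (Suc i) = members u i @ [i]" using test mem by simp
      then show "runs N (Seq (SetInt [IConst 11, V 11] (V 12)) (SetInt [IConst 11] (isucc (V 11)))) M1
        (\<lambda>M'. ?I (Suc i) M' \<and> same (under [11] \<union> scr (12 + 1)) {} M1 M')"
        using i(2,3)
        \<comment> \<open>The new member goes to the position given by the old length; the
          intermediate memory is fixed exactly because the second write reads that length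
          again.\<close>
        by (intro runs_Seq[where R = "\<lambda>M. M = ((fst M1)([11, fst M1 [11]] := int i), snd M1)"]
            runs_SetInt) (auto simp: same_def nth_append less_Suc_eq)
    next
      assume "\<not> holds M1 (ILe (IConst 1) (ICell (aT cR (V 10) cN (V 12))))"
      then have "members u (Suc i) = members u i" using test mem by simp
      then show "runs N Skip M1 (\<lambda>M'. ?I (Suc i) M' \<and> same (under [11] \<union> scr (12 + 1)) {} M1 M')"
        using i(3) by (intro runs_Skip) simp
    qed
  next
    fix i and M1 M2 :: memory assume "?I i M1" "same (scr 12) {} M1 M2"
    then show "?I i M2" using same_int[of "scr 12" "{}" M1 M2] by simp
  next
    fix M1 assume M1: "?I n M1 \<and> same (under [11] \<union> scr 12) {} M M1"
    have s0: "same ?D ?D' M0 M1"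
      by (rule same_trans_mono[OF conjunct2[OF M] conjunct2[OF M1]]) (auto simp: scr_def under_def)
    moreover have "tab M1" by (rule tab_same[OF s0 assms(1)]) auto
    ultimately show "?R2 M1" using M1 same_int[OF s0] u by (simp add: lst_def)
  qed (use M in \<open>auto simp: members_def\<close>)
  have c3: "runs N (SetInt [IConst 2, V 10, IConst 0] (V 11)) M ?R3" if M: "?R2 M" for M
  proof (rule runs_SetInt)
    let ?M = "(fst M)(map (ival M) [IConst 2, V 10, IConst 0] := ival M (V 11))"
    have "same (sub [2, int u]) {} M (?M, snd M)"
      using lstD(1)[OF conjunct1[OF M]] by (auto intro!: same_write_int)
    from R2_same[OF M this] have "?R2 (?M, snd M)" by auto
    then show "?R3 (?M, snd M)" using lstD[OF conjunct1[OF M]] by simp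
  qed
  have c4: "runs N (For 12 (V 11) (For 13 (V 11)
       (SetInt [IConst 2, V 10, IConst 1, V 12, V 13]
         (cA (ICell [IConst 11, V 12]) (ICell [IConst 11, V 13]))))) M ?R4"
    (is "runs N (For 12 (V 11) (For 13 (V 11) ?d)) M ?R4") if M: "?R3 M" for M
  proof (rule runs_mono[OF runs_For_ints[where p = "[2, int u, 1]" and nb = ?l
        and Q = "\<lambda>a M. \<forall>b<?l. fst M [2, int u, 1, int a, int b] = of_bool ({bpts u ! a, bpts u ! b} \<in> edges G)"]])
    fix M1 assume s1: "same (sub [2, int u, 1] \<union> scr 12) {} M M1"
    have R: "?R2 M1" by (rule R2_same[OF conjunct2[OF M] s1]) (auto simp: sub_def)
    then show "ival M1 (V 11) = int ?l" using lstD by simp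
    fix a assume a: "a < ?l" "fst M1 [12] = int a"
    have "runs N (For 13 (V 11) ?d) M1
      (\<lambda>M'. (\<forall>b<?l. fst M' [2, int u, 1, int a, int b] = of_bool ({bpts u ! a, bpts u ! b} \<in> edges G)) \<and>
        same (sub [2, int u, 1, int a] \<union> scr 13) {} M1 M')"
    proof (rule runs_For_ints)
      fix M2 assume s2: "same (sub [2, int u, 1, int a] \<union> scr 13) {} M1 M2"
      have R': "?R2 M2" by (rule R2_same[OF R s2]) (auto simp: sub_def scr_def)
      then show "ival M2 (V 11) = int ?l" using lstD by simp
      fix b assume b: "b < ?l" "fst M2 [13] = int b"
      have "fst M2 [12] = int a" using a same_int[OF s2] by simp
      then show "runs N ?d M2 (\<lambda>M'. fst M' [2, int u, 1, int a, int b] =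
            of_bool ({bpts u ! a, bpts u ! b} \<in> edges G) \<and>
          same (under ([2, int u, 1, int a] @ [int b]) \<union> scr (13 + 1)) {} M2 M')"
        using a(1) b lstD[OF conjunct1[OF R']] tabD(8)[OF lstD(3)[OF conjunct1[OF R']]] members_less
        by (intro runs_SetInt) (auto simp: bpts_def intro!: same_write_int)
    qed (use lN in auto)
    then show "runs N (For 13 (V 11) ?d) M1
      (\<lambda>M'. (\<forall>b<?l. fst M' [2, int u, 1, int a, int b] = of_bool ({bpts u ! a, bpts u ! b} \<in> edges G)) \<and>
        same (under ([2, int u, 1] @ [int a]) \<union> scr (12 + 1)) {} M1 M')"
      by (rule runs_mono) (auto dest: sub_under elim!: same_mono)
  next
    fix M1 assume M1: "(\<forall>a<?l. \<forall>b<?l. fst M1 [2, int u, 1, int a, int b] =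
      of_bool ({bpts u ! a, bpts u ! b} \<in> edges G)) \<and> same (sub [2, int u, 1] \<union> scr 12) {} M M1"
    have "?R2 M1" by (rule R2_same[OF conjunct2[OF M] conjunct2[OF M1]]) (auto simp: sub_def)
    then show "?R4 M1" using M M1 same_int[OF conjunct2[OF M1]] by simp
  qed (use lN in auto)
  have coord: "runs N (For 12 (V 11) (SetReal [IConst 2, V 10, IConst c, V 12]
       (LCell [IConst 0, IConst c, ICell [IConst 11, V 12]]))) M
     (\<lambda>M'. (\<forall>a<?l. snd M' [2, int u, c, int a] = f (bpts u ! a)) \<and>
       same (scr 12) (sub [2, int u, c]) M M')"
    if M: "?R2 M" and f: "\<And>M i. tab M \<Longrightarrow> i < n \<Longrightarrow> snd M [0, c, int i] = f (ps ! i)"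
    for M c and f :: "point \<Rightarrow> real"
  proof (rule runs_For_reals)
    fix M1 assume s1: "same (scr 12) (sub [2, int u, c]) M M1"
    have R: "?R2 M1" by (rule R2_same[OF M s1]) (auto simp: sub_def)
    then show "ival M1 (V 11) = int ?l" using lstD by simp
    fix a assume a: "a < ?l" "fst M1 [12] = int a"
    then show "runs N (SetReal [IConst 2, V 10, IConst c, V 12]
       (LCell [IConst 0, IConst c, ICell [IConst 11, V 12]])) M1
      (\<lambda>M'. snd M' [2, int u, c, int a] = f (bpts u ! a) \<and>
        same (scr (12 + 1)) (under ([2, int u, c] @ [int a])) M1 M')"
      using lstD[OF conjunct1[OF R]] f[OF lstD(3)[OF conjunct1[OF R]]] members_less
      by (intro runs_SetReal) (auto simp: bpts_def intro!: same_write_real)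
  qed (use lN in auto)
  have c5: "runs N (For 12 (V 11) (SetReal [IConst 2, V 10, IConst 0, V 12]
       (LCell [IConst 0, IConst 0, ICell [IConst 11, V 12]]))) M ?R5" if M: "?R4 M" for M
  proof (rule runs_mono[OF coord[of M 0 fst]])
    show "?R2 M" using M by blast
    fix M1 assume M1: "(\<forall>a<?l. snd M1 [2, int u, 0, int a] = fst (bpts u ! a)) \<and>
      same (scr 12) (sub [2, int u, 0]) M M1"
    have "?R2 M1" by (rule R2_same[OF _ conjunct2[OF M1]]) (use M in \<open>auto simp: sub_def\<close>)
    then show "?R5 M1" using M M1 same_int[OF conjunct2[OF M1]] by simp
  qed (rule tabD)
  have c6: "runs N (For 12 (V 11) (SetReal [IConst 2, V 10, IConst 1, V 12]
       (LCell [IConst 0, IConst 1, ICell [IConst 11, V 12]]))) M ?R6" if M: "?R5 M" for M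
  proof (rule runs_mono[OF coord[of M 1 snd]])
    show "?R2 M" using M by blast
    fix M1 assume M1: "(\<forall>a<?l. snd M1 [2, int u, 1, int a] = snd (bpts u ! a)) \<and>
      same (scr 12) (sub [2, int u, 1]) M M1"
    have "?R2 M1" by (rule R2_same[OF _ conjunct2[OF M1]]) (use M in \<open>auto simp: sub_def\<close>)
    then show "?R6 M1"
      using M M1 same_int[OF conjunct2[OF M1]] same_real[OF conjunct2[OF M1]] by simp
  qed (rule tabD)
  have c7: "runs N (pattern_com (V 10)) M (\<lambda>M'.
    stores_instance M' [2, int u] (geometric_graph s (set (bpts u)), set (bpts u), H, k) \<and>
    same ?D ?D' M0 M')" if M: "?R6 M" for M
  proof (rule runs_mono[OF pattern_runs[where j = "int u"]])
    have L: "lst u M" using M by blast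
    show "tab M" using lstD(3)[OF L] .
    show "ival M1 (V 10) = int u" if "same (sub [2] \<union> scr 12) {} M M1" for M1
      using same_int[OF that, of "[10]"] lstD(1)[OF L] by simp
    fix M1 assume M1: "pattern_at (int u) M1 \<and>
      same (under [2, int u, 2] \<union> under [2, int u, 3] \<union> under [2, int u, 4] \<union> scr 12) {} M M1"
    have "length (bpts u) = ?l" by (simp add: bpts_def)
    then have "points_at u (bpts u) M1"
      using M same_int[OF conjunct2[OF M1]] same_real[OF conjunct2[OF M1]] bpts_edge[OF u(2)]
      by (simp add: points_at_def)
    moreover have "?R2 M1"
      by (rule R2_same[OF _ conjunct2[OF M1]]) (use M in \<open>auto simp: sub_def under_def\<close>)
    ultimately show "stores_instance M1 [2, int u] (geometric_graph s (set (bpts u)), set (bpts u), H, k) \<and>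
      same ?D ?D' M0 M1"
      using stores_output_instance M1 distinct_bpts by blast
  qed
  show ?thesis
    unfolding ball_com_def
    by (rule runs_Seq[OF c1], rule runs_Seq[OF c2], assumption, rule runs_Seq[OF c3], assumption,
        rule runs_Seq[OF c4], assumption, rule runs_Seq[OF c5], assumption, rule runs_Seq[OF c6 c7])
qed


section \<open>The output instances: equivalence and size\<close>

definition yes_found :: bool where
  "yes_found \<longleftrightarrow> (\<exists>u<n. dense_pt m P (ps ! u)) \<or> special"

definition clique_inst :: inst where
  "clique_inst = (geometric_graph s (set cpts), set cpts, H, k)"

definition ball_inst :: "nat \<Rightarrow> inst" where
  "ball_inst u = (geometric_graph s (set (bpts u)), set (bpts u), H, k)"

definition outputs :: "inst list" where
  "outputs = (if yes_found then [clique_inst] else map ball_inst [0..<n])"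

lemma m: "3 \<le> m" "k \<le> int m"
  by (auto simp: m_def)

lemma r: "r = min m (card P)"
  by (simp add: r_def n)

lemma set_bpts': "u < n \<Longrightarrow> set (bpts u) = nbh (edges G) {} (ps ! u) r"
  by (simp add: set_bpts ball_def)

lemma ex_P: "(\<exists>p\<in>P. B p) \<longleftrightarrow> (\<exists>u<n. B (ps ! u))"
  unfolding ps(2)[symmetric] by (metis in_set_conv_nth)

text \<open>The bound on \<open>m\<close> holds because each reason for a yes limits
  \<open>m\<close>: a dense square contains \<open>m\<close> points, a far pair forces
  \<open>m\<close> points on a closed path, and \<open>k \<le> 0\<close> gives \<open>m = 3\<close>.
  The last case, possibly without any point, accounts for the summand 3 in the loop bound.\<close>

lemma yes_foundD:
  assumes yes_found
  shows "yes_instance prob (G, P, H, k)" "m \<le> N + 3"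
proof -
  have "yes_instance prob (G, P, H, k) \<and> m \<le> N + 3"
  proof (cases "\<exists>u<n. dense_pt m P (ps ! u)")
    case True
    then obtain u where u: "dense_pt m P (ps ! u)" by blast
    have "card {q \<in> P. near (1/2) (ps ! u) q} \<le> card P" using G(2) by (intro card_mono) auto
    then have "m \<le> n" using dense_pt_clique(1)[OF u] n by simp
    then show ?thesis using yes_if_dense[OF inst u m(2,1)] by simp
  next
    case False
    then have sp: special using assms unfolding yes_found_def by blast
    show ?thesis
    proof (cases prob)
      case Subgraph_Isomorphism
      then have "k \<le> 0" using sp unfolding special_def by simp
      moreover have "simple_graph H" "k = int (card (verts H))"
        using inst unfolding Subgraph_Isomorphism by simp_all
      ultimately have "\<exists>S. subgraph S G \<and> isomorphic S H"
        unfolding G(1) by (intro clique_subgraph[of H "{}"]) auto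
      moreover have "m \<le> N + 3" using \<open>k \<le> 0\<close> by (simp add: m_def)
      ultimately show ?thesis unfolding Subgraph_Isomorphism by simp
    next
      case Longest_Cycle
      then obtain u w where far: "far (edges G) n r (ps ! u) (ps ! w)"
        using sp unfolding special_def by auto
      show ?thesis
        using far_yes[OF inst[unfolded Longest_Cycle] far r m(2,1)] n
        unfolding Longest_Cycle by simp
    qed
  qed
  then show "yes_instance prob (G, P, H, k)" "m \<le> N + 3" by auto
qed

lemma clique_inst:
  "is_instance prob s clique_inst" "yes_instance prob clique_inst"
proof -
  have card: "card (set cpts) = m" using cpts(1,2) distinct_card by metis
  have "connected_graph (geometric_graph s (set cpts))"
    unfolding connected_graph_def
  proof (intro ballI)
    fix p q assume "p \<in> verts (geometric_graph s (set cpts))" "q \<in> verts (geometric_graph s (set cpts))"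
    then have "p = q \<or> {p, q} \<in> edges (geometric_graph s (set cpts))"
      using cpts_close by (simp add: edge_geometric_graph)
    then show "(\<lambda>x y. {x, y} \<in> edges (geometric_graph s (set cpts)))\<^sup>*\<^sup>* p q" by auto
  qed
  then show "is_instance prob s clique_inst"
    unfolding clique_inst_def using inst by (cases prob) simp_all
  show "yes_instance prob clique_inst"
  proof (cases prob)
    case Subgraph_Isomorphism
    have "simple_graph H" "card (verts H) \<le> card (set cpts)"
      using inst m(2) card unfolding Subgraph_Isomorphism by simp_all
    then show ?thesis
      using clique_subgraph[of H "set cpts" "set cpts" s] cpts_close
      unfolding Subgraph_Isomorphism clique_inst_def yes_instance.simps by blast
  next
    case Longest_Cycle
    then show ?thesis
      using clique_cycle[of "set cpts" "set cpts" s] cpts_close card m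
      unfolding Longest_Cycle clique_inst_def yes_instance.simps by auto
  qed
qed

lemma ball_inst:
  assumes "u < n"
  shows "is_instance prob s (ball_inst u)"
proof -
  have "connected_graph (geometric_graph s (set (bpts u)))"
    unfolding set_bpts'[OF assms] unfolding G(1) by (rule connected_geometric_nbh[OF nth_P[OF assms]])
  then show ?thesis unfolding ball_inst_def using inst by (cases prob) simp_all
qed

text \<open>Without points both sides are false: a cycle has vertices, and so has the pattern, since
  \<open>k \<le> 0\<close> counts as \<open>special\<close>.\<close>

lemma ball_yes:
  assumes "\<not> yes_found"
  shows "yes_instance prob (G, P, H, k) \<longleftrightarrow> (\<exists>u<n. yes_instance prob (ball_inst u))"
proof -
  have sp: "\<not> special" using assms by (simp add: yes_found_def)
  have eq: "ball_inst u = (geometric_graph s (nbh (edges G) {} (ps ! u) r),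
      nbh (edges G) {} (ps ! u) r, H, k)" if "u < n" for u
    using set_bpts'[OF that] by (simp add: ball_inst_def)
  show ?thesis
  proof (cases prob)
    case Subgraph_Isomorphism
    then have "0 < k" using sp unfolding special_def by simp
    moreover have "k \<le> int r \<or> card P \<le> r" using m(2) by (auto simp: r)
    ultimately have "yes_instance Subgraph_Isomorphism (G, P, H, k) \<longleftrightarrow>
        (\<exists>u<n. \<exists>S. subgraph S (geometric_graph s (nbh (edges G) {} (ps ! u) r)) \<and> isomorphic S H)"
      using subgraph_isomorphism_nbh[OF inst[unfolded Subgraph_Isomorphism]] unfolding ex_P by blast
    then show ?thesis
      unfolding Subgraph_Isomorphism using eq by (metis yes_instance.simps(1))
  next
    case Longest_Cycle
    then have "\<not> far (edges G) n r p q" if "p \<in> P" "q \<in> P" for p q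
      using sp that unfolding special_def ps(2)[symmetric] in_set_conv_nth by auto
    then have "yes_instance Longest_Cycle (G, P, H, k) \<longleftrightarrow>
        (\<exists>u<n. \<exists>vs. cycle (geometric_graph s (nbh (edges G) {} (ps ! u) r)) vs \<and> k \<le> int (length vs))"
      using longest_cycle_nbh[OF inst[unfolded Longest_Cycle], of r] unfolding ex_P n by blast
    then show ?thesis
      unfolding Longest_Cycle using eq by (metis yes_instance.simps(2))
  qed
qed

lemma outputs_correct:
  "\<forall>X\<in>set outputs. is_instance prob s X"
  "yes_instance prob (G, P, H, k) \<longleftrightarrow> (\<exists>X\<in>set outputs. yes_instance prob X)"
  using yes_foundD(1) clique_inst ball_inst ball_yes by (auto simp: outputs_def)

text \<open>The constants come from the balls, with 81 for the vertices and
  \<open>81 * 81 = 6561\<close> for the edges. A clique on \<open>m\<close> vertices has at most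
  \<open>m ^ 2\<close> edges and stays below both bounds.\<close>

lemma outputs_small:
  assumes "(G', P', H', k') \<in> set outputs"
  shows "card (verts G') \<le> 81 * m ^ 3" "card (edges G') \<le> 6561 * m ^ 4" "H' = H" "k' = k"
proof -
  have "card (verts G') \<le> 81 * m ^ 3 \<and> card (edges G') \<le> 6561 * m ^ 4 \<and> H' = H \<and> k' = k"
  proof (cases yes_found)
    case True
    then have G': "G' = geometric_graph s (set cpts)" "H' = H" "k' = k"
      using assms by (simp_all add: outputs_def clique_inst_def)
    have card: "card (set cpts) = m" using cpts(1,2) distinct_card by metis
    have "edges G' \<subseteq> (\<lambda>(p, q). {p, q}) ` (set cpts \<times> set cpts)"
      unfolding G'(1) by (force elim!: edges_geometric_graphD)
    then have "card (edges G') \<le> card (set cpts \<times> set cpts)"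
      by (rule surj_card_le[rotated]) simp
    also have "\<dots> = m ^ 2" by (simp add: card_cartesian_product card power2_eq_square)
    also have "\<dots> \<le> m ^ 4" using m(1) by (intro power_increasing) auto
    finally have "card (edges G') \<le> 6561 * m ^ 4" by simp
    moreover have "m ^ 1 \<le> m ^ 3" using m(1) by (intro power_increasing) auto
    ultimately show ?thesis using G' card by simp
  next
    case False
    then obtain u where u: "u < n" "(G', P', H', k') = ball_inst u"
      using assms by (auto simp: outputs_def)
    then have G': "G' = geometric_graph s (set (bpts u))" "H' = H" "k' = k"
      by (simp_all add: ball_inst_def)
    \<comment> \<open>Balls are output only after the density test has failed at every point, which
      is what the counting lemmas assume.\<close>
    have sparse: "\<not> dense_pt m P p" if "p \<in> P" for p
      using False that ex_P[of "dense_pt m P"] unfolding yes_found_def by blast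
    have B: "set (bpts u) \<subseteq> P" using set_bpts[OF u(1)] ball_subset[OF u(1)] by simp
    have c: "card (set (bpts u)) \<le> 81 * m ^ 3"
      using card_nbh_le[OF G(2) sparse nth_P[OF u(1)], of r s "{}"] m(1) r_le(2)
      unfolding set_bpts'[OF u(1)] unfolding G(1) by simp
    have "card (edges G') \<le> card (set (bpts u)) * (81 * m)"
      unfolding G'(1) by (rule card_edges_le[OF G(2) sparse B])
    also have "\<dots> \<le> (81 * m ^ 3) * (81 * m)" by (rule mult_right_mono[OF c]) simp
    finally have "card (edges G') \<le> 6561 * m ^ 4" by (simp add: power_numeral_reduce)
    then show ?thesis using c G' by simp
  qed
  then show "card (verts G') \<le> 81 * m ^ 3" "card (edges G') \<le> 6561 * m ^ 4" "H' = H" "k' = k"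
    by auto
qed

section \<open>Assembling the program\<close>

lemma balls_runs:
  assumes "tab M0"
  shows "runs N (For 10 cN ball_com) M0
    (\<lambda>M'. (\<forall>u<n. stores_instance M' [2, int u] (ball_inst u)) \<and>
      same (sub [2] \<union> scr 10) (sub [2]) M0 M')"
proof (rule runs_For_cells)
  fix M assume s: "same (sub [2] \<union> scr 10) (sub [2]) M0 M"
  have "tab M" by (rule tab_same[OF s assms]) auto
  then show "ival M cN = int n" by (simp add: tabD)
  fix u assume "u < n" "fst M [10] = int u"
  then show "runs N ball_com M (\<lambda>M'. stores_instance M' [2, int u] (ball_inst u) \<and>
      same (under ([2] @ [int u]) \<union> scr (10 + 1)) (under ([2] @ [int u])) M M')"
    using ball_runs[OF \<open>tab M\<close>] by (simp add: ball_inst_def)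
next
  fix u and M M' :: memory
  assume "stores_instance M [2, int u] (ball_inst u)"
    "\<forall>a\<in>under ([2] @ [int u]). fst M' a = fst M a" "\<forall>a\<in>under ([2] @ [int u]). snd M' a = snd M a"
  then show "stores_instance M' [2, int u] (ball_inst u)"
    using stores_instance_cong[of M "[2, int u]" "ball_inst u" M'] by simp
qed auto

lemma kernel_runs:
  assumes "inp M0"
  shows "runs N (kernel_com prob) M0 (\<lambda>M'. stores_output M' (set outputs))"
proof -
  let ?R3 = "\<lambda>M. fst M [3] = 0 \<and> tab M"
  let ?R4 = "\<lambda>M. fst M [3] = of_bool (\<exists>u<n. dense_pt m P (ps ! u)) \<and> tab M"
  let ?R5 = "\<lambda>M. fst M [3] = of_bool yes_found \<and> tab M"
  let ?Q = "\<lambda>M'. stores_output M' (set outputs)"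
  have c3: "runs N (SetInt [IConst 3] (IConst 0)) M ?R3" if "tab M" for M
  proof (rule runs_SetInt)
    have "same {[3]} {} M ((fst M)([3] := 0), snd M)" by (simp add: same_write_int)
    from tab_same[OF this that] show "?R3 ((fst M)(map (ival M) [IConst 3] := ival M (IConst 0)), snd M)"
      by simp
  qed
  have c4: "runs N dense_com M ?R4" if M: "?R3 M" for M
  proof (rule runs_mono[OF dense_runs])
    show "tab M" using M by blast
    fix M' assume M': "fst M' [3] = (if \<exists>u<n. dense_pt m P (ps ! u) then 1 else fst M [3]) \<and>
      same (insert [3] (scr 10)) {} M M'"
    have "tab M'" by (rule tab_same[OF conjunct2[OF M']]) (use M in auto)
    then show "?R4 M'" using M M' by simp
  qed
  have c5: "runs N (special_com prob) M ?R5" if M: "?R4 M" for M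
  proof (rule runs_mono[OF special_runs])
    show "tab M" using M by blast
    fix M' assume M': "fst M' [3] = (if special then 1 else fst M [3]) \<and>
      same (insert [3] (scr 10)) {} M M'"
    have "tab M'" by (rule tab_same[OF conjunct2[OF M']]) (use M in auto)
    then show "?R5 M'" using M M' by (simp add: yes_found_def)
  qed
  have balls: "runs N (Seq (SetInt [IConst 1] cN) (For 10 cN ball_com)) M ?Q"
    if M: "tab M" "\<not> yes_found" for M
  proof (rule runs_Seq[OF runs_SetInt])
    let ?M = "((fst M)(map (ival M) [IConst 1] := ival M cN), snd M)"
    show "tab ?M \<and> fst ?M [1] = int n"
      using tab_same[OF same_write_int[of "[1]" "{[1]}" "{}"] M(1)] tabD(1)[OF M(1)] by simp
    fix M1 assume M1: "tab M1 \<and> fst M1 [1] = int n"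
    show "runs N (For 10 cN ball_com) M1 ?Q"
    proof (rule runs_mono[OF balls_runs])
      show "tab M1" using M1 by blast
      fix M' assume M': "(\<forall>u<n. stores_instance M' [2, int u] (ball_inst u)) \<and>
        same (sub [2] \<union> scr 10) (sub [2]) M1 M'"
      have "fst M' [1] = int n" using same_int[OF conjunct2[OF M'], of "[1]"] M1 by simp
      then show "?Q M'"
        using M' M(2) unfolding stores_output_def by (intro exI[of _ outputs]) (simp add: outputs_def)
    qed
  qed
  have clique: "runs N clique_com M ?Q" if M: "tab M" yes_found for M
  proof (rule runs_mono[OF clique_runs[OF M(1) yes_foundD(2)[OF M(2)]]])
    fix M' assume "fst M' [1] = 1 \<and>
      stores_instance M' [2, 0] (geometric_graph s (set cpts), set cpts, H, k)"
    then show "?Q M'"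
      using M(2) unfolding stores_output_def
      by (intro exI[of _ outputs]) (simp add: outputs_def clique_inst_def)
  qed
  have c6: "runs N (Cond (ILe (IConst 1) (V 3)) clique_com
       (Seq (SetInt [IConst 1] cN) (For 10 cN ball_com))) M ?Q" if M: "?R5 M" for M
    using M by (cases yes_found) (auto intro!: runs_Cond clique balls)
  show ?thesis
    unfolding kernel_com_def
    by (rule runs_Seq[OF params_runs[OF assms]], rule runs_Seq[OF table_runs], assumption,
        rule runs_Seq[OF c3], assumption, rule runs_Seq[OF c4], assumption, rule runs_Seq[OF c5 c6])
qed

end

theorem theorem21:
  fixes prob :: problem and s :: shape
  shows "\<exists>(c :: com) (q :: nat poly) (f :: int \<Rightarrow> real) (g :: int \<Rightarrow> real).
    f \<in> O(\<lambda>k. real_of_int k ^ 3) \<and> g \<in> O(\<lambda>k. real_of_int k ^ 4) \<and>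
    (\<forall>G P H k M.
      is_instance prob s (G, P, H, k) \<and> stores_input M (G, P, H, k) \<longrightarrow>
      (\<exists>t M' \<I>.
        exec c M t M' \<and> t \<le> poly q (inst_size (G, P, H, k)) \<and> stores_output M' \<I> \<and>
        (\<forall>X\<in>\<I>. is_instance prob s X) \<and>
        (yes_instance prob (G, P, H, k) \<longleftrightarrow> (\<exists>X\<in>\<I>. yes_instance prob X)) \<and>
        (\<forall>(G', P', H', k')\<in>\<I>.
          real (card (verts G')) \<le> f k \<and> real (card (edges G')) \<le> g k \<and> H' = H \<and> k' = k)))"
proof -
  \<comment> \<open>The time bound is read off the program text, which depends on the problem but
    not on the shape or the instance.\<close>
  obtain q where q: "\<And>N. tm N (kernel_com prob) = poly q N" using tm_poly by metis
  \<comment> \<open>The value \<open>m\<close>, as a function of \<open>k\<close> alone.\<close>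
  define b where "b k = max 3 (nat k)" for k
  define f where "f k = 81 * real (b k) ^ 3" for k
  define g where "g k = 6561 * real (b k) ^ 4" for k
  \<comment> \<open>The Landau symbols concern large \<open>k\<close>, where the maximum with 3 has
    no effect; the size bounds themselves hold for all \<open>k\<close>.\<close>
  have b: "eventually (\<lambda>k. real (b k) = real_of_int k) at_top"
    using eventually_ge_at_top[of 3] by eventually_elim (simp add: b_def)
  have "f \<in> O(\<lambda>k. real_of_int k ^ 3)"
    by (rule bigoI[of _ 81], use b in eventually_elim) (simp add: f_def)
  moreover have "g \<in> O(\<lambda>k. real_of_int k ^ 4)"
    by (rule bigoI[of _ 6561], use b in eventually_elim) (simp add: g_def)
  moreover have "\<exists>t M' \<I>.
      exec (kernel_com prob) M t M' \<and> t \<le> poly q (inst_size (G, P, H, k)) \<and> stores_output M' \<I> \<and>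
      (\<forall>X\<in>\<I>. is_instance prob s X) \<and>
      (yes_instance prob (G, P, H, k) \<longleftrightarrow> (\<exists>X\<in>\<I>. yes_instance prob X)) \<and>
      (\<forall>(G', P', H', k')\<in>\<I>.
        real (card (verts G')) \<le> f k \<and> real (card (edges G')) \<le> g k \<and> H' = H \<and> k' = k)"
    if I: "is_instance prob s (G, P, H, k)" "stores_input M (G, P, H, k)" for G P H k M
  proof -
    obtain ps hs where *: "distinct ps" "set ps = P" "distinct hs" "set hs = verts H"
      "fst M [0, 0] = int (length ps)"
      "\<forall>i<length ps. snd M [0, 0, int i] = fst (ps ! i) \<and> snd M [0, 1, int i] = snd (ps ! i)"
      "\<forall>i<length ps. \<forall>j<length ps.
        fst M [0, 1, int i, int j] = (if {ps ! i, ps ! j} \<in> edges G then 1 else 0)"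
      "fst M [0, 2] = int (length hs)" "\<forall>i<length hs. fst M [0, 2, int i] = int (hs ! i)"
      "\<forall>i<length hs. \<forall>j<length hs.
        fst M [0, 3, int i, int j] = (if {hs ! i, hs ! j} \<in> edges H then 1 else 0)"
      "fst M [0, 4] = k"
      using I(2) unfolding stores_input_def stores_instance_iff by auto
    interpret stored_instance prob s G P H k ps hs
      by unfold_locales (use I(1) * in auto)
    have "inp M" using * by (simp add: inp_def of_bool_def)
    from kernel_runs[OF this] obtain t M' where run: "exec (kernel_com prob) M t M'"
      "t \<le> tm (length ps + length hs) (kernel_com prob)" "stores_output M' (set outputs)"
      unfolding runs_def by blast
    \<comment> \<open>The lists have no repetitions, so the \<open>N\<close> of the loop bounds is
      exactly the instance size.\<close>
    have size: "inst_size (G, P, H, k) = length ps + length hs"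
      using *(1-4) distinct_card[of ps] distinct_card[of hs] by simp
    have small: "real (card (verts G')) \<le> f k \<and> real (card (edges G')) \<le> g k \<and> H' = H \<and> k' = k"
      if "(G', P', H', k') \<in> set outputs" for G' P' H' k'
    proof -
      have "real (card (verts G')) \<le> real (81 * b k ^ 3)" "real (card (edges G')) \<le> real (6561 * b k ^ 4)"
        using outputs_small(1,2)[OF that] unfolding of_nat_le_iff b_def m_def by auto
      then show ?thesis using outputs_small(3,4)[OF that] by (simp add: f_def g_def)
    qed
    show ?thesis
      by (rule exI[of _ t], rule exI[of _ M'], rule exI[of _ "set outputs"])
        (use run q size outputs_correct small in auto)
  qed
  ultimately show ?thesis by blast
qed

end
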